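(* Let $E$ be an $F$-space over $\mathbb{K}$ ($\mathbb{K}=\mathbb{R}$ or $\mathbb{C}$) and let $W$ be a vector subspace of $E$ (not necessarily closed) that contains a non-minimal closed subspace of $E$. Then the set $E\setminus W$ is spaceable if and only if there exist a closed subspace $\mathcal{S}$ of $\ell_\infty$ with $c_0\subseteq\mathcal{S}$ and an $\mathcal{S}$-independent sequence $(x_n)_{n=1}^\infty$ of elements of $E$ such that $E\setminus W$ is $[(x_n)_{n=1}^\infty,\mathcal{S}]$-lineable.
   Context: All vector spaces are over $\mathbb{K}=\mathbb{R}$ or $\mathbb{C}$; "subspace" means vector subspace. An $F$-space is a topological vector space whose topology is induced by a complete translation-invariant metric (no local convexity is assumed). The spaces $c_0\subseteq\ell_\infty\subseteq\mathbb{K}^{\mathbb{N}}$ are the usual spaces of null and bounded scalar sequences, and "closed subspace of $\ell_\infty$" refers to the supremum norm. A Hausdorff topological vector space is minimal if it admits no strictly weaker Hausdorff vector topology; it is non-minimal otherwise. A closed subspace of $E$ is called (non-)minimal if it is so with the topology induced from $E$. A subset $A$ of a topological vector space $E$ is spaceable if $A\cup\{0\}$ contains an infinite-dimensional closed subspace of $E$. Let $\mathcal{S}\neq\{0\}$ be a subspace of $\mathbb{K}^{\mathbb{N}}$. A sequence $(u_n)_{n=1}^\infty$ in a topological vector space $E$ is $\mathcal{S}$-independent if, whenever $(c_n)_{n=1}^\infty\in\mathcal{S}$ satisfies $\sum_{n=1}^\infty c_nu_n=0$ (convergent series), one has $c_n=0$ for all $n$. A subset $A$ of a Hausdorff topological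 vector space $E$ is $[(u_n)_{n=1}^\infty,\mathcal{S}]$-lineable (in $E$) if for each $(c_n)_{n=1}^\infty\in\mathcal{S}$ the series $\sum_{n=1}^\infty c_nu_n$ converges in $E$ to a vector in $A\cup\{0\}$. *)

theory Defs
  imports "HOL-Analysis.Analysis" "HOL-Library.Function_Algebras"
begin

text \<open>The scalar fields: \<open>\<real>\<close> and \<open>\<complex>\<close>. An additive, multiplicative and norm-preserving map into
  \<open>\<complex>\<close> is injective, so a type of this class is isometrically isomorphic, as a field, to one of
  these two.\<close>

class real_or_complex = real_normed_field +
  assumes real_or_complex_embedding:
    "\<exists>h :: 'a \<Rightarrow> complex.
       (\<forall>x y. h (x + y) = h x + h y) \<and> (\<forall>x y. h (x * y) = h x * h y) \<and>
       (\<forall>x. norm (h x) = norm x) \<and> (range h = \<real> \<or> range h = UNIV)"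

instance real :: real_or_complex
proof
  show "\<exists>h :: real \<Rightarrow> complex.
       (\<forall>x y. h (x + y) = h x + h y) \<and> (\<forall>x y. h (x * y) = h x * h y) \<and>
       (\<forall>x. norm (h x) = norm x) \<and> (range h = \<real> \<or> range h = UNIV)"
    by (intro exI[of _ complex_of_real]) (auto simp: Reals_def)
qed

instance complex :: real_or_complex
proof
  show "\<exists>h :: complex \<Rightarrow> complex.
       (\<forall>x y. h (x + y) = h x + h y) \<and> (\<forall>x y. h (x * y) = h x * h y) \<and>
       (\<forall>x. norm (h x) = norm x) \<and> (range h = \<real> \<or> range h = UNIV)"
    by (intro exI[of _ "\<lambda>x. x"]) auto
qed

text \<open>A topological vector space is an abstract topology \<open>E\<close> whose carrier \<open>topspace E\<close> is a
  subspace of an ambient vector space with scalar multiplication \<open>smul\<close>.  Separation is not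
  part of the definition.  A subspace \<open>S\<close> with the induced topology is \<open>subtopology E S\<close>.\<close>

definition tvs :: "('k::real_normed_field \<Rightarrow> 'a::ab_group_add \<Rightarrow> 'a) \<Rightarrow> 'a topology \<Rightarrow> bool" where
  "tvs smul E \<longleftrightarrow>
     vector_space smul \<and> module.subspace smul (topspace E) \<and>
     continuous_map (prod_topology E E) E (\<lambda>(x, y). x + y) \<and>
     continuous_map (prod_topology euclidean E) E (\<lambda>(a, x). smul a x)"

definition F_space :: "('k::real_normed_field \<Rightarrow> 'a::ab_group_add \<Rightarrow> 'a) \<Rightarrow> 'a topology \<Rightarrow> bool" where
  "F_space smul E \<longleftrightarrow>
     tvs smul E \<and>
     (\<exists>d. Metric_space (topspace E) d \<and>
          (\<forall>x\<in>topspace E. \<forall>y\<in>topspace E. \<forall>z\<in>topspace E. d (x + z) (y + z) = d x y) \<and>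
          Metric_space.mcomplete (topspace E) d \<and>
          E = Metric_space.mtopology (topspace E) d)"

definition minimal_tvs :: "('k::real_normed_field \<Rightarrow> 'a::ab_group_add \<Rightarrow> 'a) \<Rightarrow> 'a topology \<Rightarrow> bool" where
  "minimal_tvs smul E \<longleftrightarrow>
     tvs smul E \<and> Hausdorff_space E \<and>
     \<not> (\<exists>E'. topspace E' = topspace E \<and> tvs smul E' \<and> Hausdorff_space E' \<and>
             (\<forall>U. openin E' U \<longrightarrow> openin E U) \<and> E' \<noteq> E)"

definition nonminimal_tvs :: "('k::real_normed_field \<Rightarrow> 'a::ab_group_add \<Rightarrow> 'a) \<Rightarrow> 'a topology \<Rightarrow> bool" where
  "nonminimal_tvs smul E \<longleftrightarrow> tvs smul E \<and> Hausdorff_space E \<and> \<not> minimal_tvs smul E"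

definition closed_subspace ::
  "('k::real_normed_field \<Rightarrow> 'a::ab_group_add \<Rightarrow> 'a) \<Rightarrow> 'a topology \<Rightarrow> 'a set \<Rightarrow> bool" where
  "closed_subspace smul E S \<longleftrightarrow> module.subspace smul S \<and> closedin E S"

definition infinite_dimensional ::
  "('k::real_normed_field \<Rightarrow> 'a::ab_group_add \<Rightarrow> 'a) \<Rightarrow> 'a set \<Rightarrow> bool" where
  "infinite_dimensional smul S \<longleftrightarrow> \<not> (\<exists>B. finite B \<and> B \<subseteq> S \<and> S \<subseteq> module.span smul B)"

definition spaceable ::
  "('k::real_normed_field \<Rightarrow> 'a::ab_group_add \<Rightarrow> 'a) \<Rightarrow> 'a topology \<Rightarrow> 'a set \<Rightarrow> bool" where
  "spaceable smul E A \<longleftrightarrow>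
     (\<exists>S. closed_subspace smul E S \<and> infinite_dimensional smul S \<and> S \<subseteq> A \<union> {0})"

text \<open>Scalar sequences are indexed from \<open>0\<close>; \<open>seq_scale\<close> is the scalar multiplication of
  \<open>K\<^sup>\<nat>\<close>, whose addition is the pointwise one of \<open>Function_Algebras\<close>.\<close>

definition seq_scale :: "'k::real_normed_field \<Rightarrow> (nat \<Rightarrow> 'k) \<Rightarrow> nat \<Rightarrow> 'k" where
  "seq_scale a c = (\<lambda>n. a * c n)"

definition linf :: "(nat \<Rightarrow> 'k::real_normed_field) set" where
  "linf = {c. bounded (range c)}"

definition c0 :: "(nat \<Rightarrow> 'k::real_normed_field) set" where
  "c0 = {c. c \<longlonglongrightarrow> 0}"

text \<open>The value \<open>0\<close> off \<open>linf\<close> is a convention: \<open>Metric_space\<close> requires the distance function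
  to be nonnegative on the whole type.\<close>

definition sup_norm :: "(nat \<Rightarrow> 'k::real_normed_field) \<Rightarrow> real" where
  "sup_norm c = (if c \<in> linf then SUP n. norm (c n) else 0)"

definition linf_topology :: "(nat \<Rightarrow> 'k::real_normed_field) topology" where
  "linf_topology = Metric_space.mtopology linf (\<lambda>c d. sup_norm (c - d))"

lemma vector_space_seq_scale: "vector_space (seq_scale :: 'k::real_normed_field \<Rightarrow> _)"
  by unfold_locales (auto simp: seq_scale_def fun_eq_iff algebra_simps)

lemma sup_norm_upper:
  assumes "c \<in> linf" shows "norm (c n) \<le> sup_norm c"
proof -
  obtain B where "\<And>n. norm (c n) \<le> B"
    using assms by (auto simp: linf_def bounded_iff)
  then have "bdd_above (range (\<lambda>n. norm (c n)))"
    by (auto intro!: bdd_aboveI)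
  from cSUP_upper[OF UNIV_I this] show ?thesis
    using assms by (simp add: sup_norm_def)
qed

lemma sup_norm_nonneg: "0 \<le> sup_norm c"
proof (cases "c \<in> linf")
  case True
  show ?thesis
    using order_trans[OF norm_ge_zero sup_norm_upper[OF True]] .
qed (simp add: sup_norm_def)

lemma sup_norm_minus_commute: "sup_norm (c - d) = sup_norm (d - c)"
proof -
  have "c - d \<in> linf \<longleftrightarrow> d - c \<in> linf"
    by (auto simp: linf_def bounded_iff norm_minus_commute)
  then show ?thesis
    by (simp add: sup_norm_def norm_minus_commute)
qed

lemma linf_diff: "c \<in> linf \<Longrightarrow> d \<in> linf \<Longrightarrow> c - d \<in> linf"
  using bounded_minus_comp[of c UNIV d] by (simp add: linf_def fun_diff_def)

lemma Metric_space_linf: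
  "Metric_space (linf :: (nat \<Rightarrow> 'k::real_normed_field) set) (\<lambda>c d. sup_norm (c - d))"
proof
  fix c d e :: "nat \<Rightarrow> 'k"
  show "sup_norm (c - d) = sup_norm (d - c)"
    by (rule sup_norm_minus_commute)
  show "0 \<le> sup_norm (c - d)"
    by (rule sup_norm_nonneg)
  show "sup_norm (c - d) = 0 \<longleftrightarrow> c = d" if "c \<in> linf" "d \<in> linf"
  proof
    assume "sup_norm (c - d) = 0"
    then have "norm (c n - d n) \<le> 0" for n
      using sup_norm_upper[OF linf_diff[OF that], of n] by simp
    then show "c = d" by (simp add: fun_eq_iff)
  qed (simp add: sup_norm_def)
  show "sup_norm (c - e) \<le> sup_norm (c - d) + sup_norm (d - e)"
    if "c \<in> linf" "d \<in> linf" "e \<in> linf"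
  proof -
    have "norm ((c - e) n) \<le> sup_norm (c - d) + sup_norm (d - e)" for n
    proof -
      have "norm ((c - e) n) \<le> norm ((c - d) n) + norm ((d - e) n)"
        using norm_triangle_ineq[of "(c - d) n" "(d - e) n"] by simp
      also have "\<dots> \<le> sup_norm (c - d) + sup_norm (d - e)"
        using that by (intro add_mono sup_norm_upper linf_diff)
      finally show ?thesis .
    qed
    then show ?thesis
      using linf_diff[OF that(1,3)] unfolding sup_norm_def[of "c - e"]
      by (auto intro!: cSUP_least)
  qed
qed

text \<open>Convergence of \<open>\<Sum>c\<^sub>nu\<^sub>n\<close> to \<open>x\<close> in \<open>E\<close>, as a limit of partial sums.\<close>

definition series_converges_to ::
  "('k::real_normed_field \<Rightarrow> 'a::ab_group_add \<Rightarrow> 'a) \<Rightarrow> 'a topology \<Rightarrow>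
   (nat \<Rightarrow> 'a) \<Rightarrow> (nat \<Rightarrow> 'k) \<Rightarrow> 'a \<Rightarrow> bool" where
  "series_converges_to smul E u c x \<longleftrightarrow>
     limitin E (\<lambda>N. \<Sum>n<N. smul (c n) (u n)) x sequentially"

definition S_independent ::
  "('k::real_normed_field \<Rightarrow> 'a::ab_group_add \<Rightarrow> 'a) \<Rightarrow> 'a topology \<Rightarrow>
   (nat \<Rightarrow> 'k) set \<Rightarrow> (nat \<Rightarrow> 'a) \<Rightarrow> bool" where
  "S_independent smul E \<S> u \<longleftrightarrow>
     (\<forall>c\<in>\<S>. series_converges_to smul E u c 0 \<longrightarrow> (\<forall>n. c n = 0))"

definition S_lineable ::
  "('k::real_normed_field \<Rightarrow> 'a::ab_group_add \<Rightarrow> 'a) \<Rightarrow> 'a topology \<Rightarrow>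
   (nat \<Rightarrow> 'a) \<Rightarrow> (nat \<Rightarrow> 'k) set \<Rightarrow> 'a set \<Rightarrow> bool" where
  "S_lineable smul E u \<S> A \<longleftrightarrow>
     (\<forall>c\<in>\<S>. \<exists>x\<in>A \<union> {0}. series_converges_to smul E u c x)"

end

theory Submission
  imports Defs
begin

text \<open>If a closed subspace \<open>S\<close> of infinite dimension meets \<open>W\<close> only in \<open>0\<close>, choose linearly
  independent \<open>x n \<in> S\<close> decreasing so fast that the series \<open>\<Sum>n. c n x n\<close> converge for all bounded \<open>c\<close>
  and vanish only for \<open>c = 0\<close>.

  Conversely, a non-minimal closed subspace \<open>M \<subseteq> W\<close> contains a basic sequence \<open>e\<close> with bounded
  coefficient functionals, in the topology of an F-norm \<open>p\<close> that is lower semicontinuous for a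
  strictly weaker vector topology (Kalton). For scalars \<open>\<tau> n\<close> tending to \<open>0\<close> fast enough, the closed
  span of the vectors \<open>e n + \<tau> n x n\<close> consists of vectors \<open>w + \<Sum>n. \<alpha> n \<tau> n x n\<close> with \<open>w \<in> M\<close> and
  \<open>\<alpha> \<in> c0\<close>. Such a vector lies in \<open>W\<close> only if the series does, hence only if \<open>\<alpha> = 0\<close>, and then
  the vector is \<open>0\<close> because \<open>e\<close> is basic.\<close>

section \<open>F-norms\<close>

text \<open>Without local convexity there may be no nonzero continuous functional, so Hahn-Banach
  cannot supply coefficient functionals; the strictly weaker Hausdorff vector topology takes over
  the role of a weak topology. Vectors that are small for it yet bounded away from 0 can be appended
  to a finite combination with hardly any loss in a functional that is lower semicontinuous for it,
  which is why \<open>N\<close> is replaced by an envelope \<open>p\<close>. F-norms are not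
  homogeneous, so coefficient bounds are claimed only below a threshold \<open>\<delta>\<close>, and
  normalisation goes through integer multiples or intermediate values. The \<open>x n\<close> alone
  would not do for the converse: a limit of their finite combinations need not be the sum of a
  series with coefficients in \<open>c0\<close>, and lineability says nothing about other limits.
  Adding \<open>e n\<close> forces the coefficients to converge. \<open>W\<close> need not be
  closed, so the limits of the \<open>e\<close>-parts are kept in \<open>W\<close> by the closed
  space \<open>M\<close>. In the forward direction \<open>\<S>\<close> is all of
  \<open>linf\<close>.\<close>

locale F_norm = vector_space smul
  for smul :: "'k::real_or_complex \<Rightarrow> 'a::ab_group_add \<Rightarrow> 'a" (infixr "*s" 75) +
  fixes X :: "'a set" and N :: "'a \<Rightarrow> real"
  assumes subspace_X: "subspace X"
    and eq_0: "x \<in> X \<Longrightarrow> N x = 0 \<Longrightarrow> x = 0"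
    and triangle: "x \<in> X \<Longrightarrow> y \<in> X \<Longrightarrow> N (x + y) \<le> N x + N y"
    and balanced: "x \<in> X \<Longrightarrow> norm t \<le> 1 \<Longrightarrow> N (t *s x) \<le> N x"
    and absorbing: "x \<in> X \<Longrightarrow> 0 < \<epsilon> \<Longrightarrow> \<exists>r>0. \<forall>t. norm t < r \<longrightarrow> N (t *s x) < \<epsilon>"
begin

lemma X_0: "0 \<in> X"
  and X_add: "x \<in> X \<Longrightarrow> y \<in> X \<Longrightarrow> x + y \<in> X"
  and X_diff: "x \<in> X \<Longrightarrow> y \<in> X \<Longrightarrow> x - y \<in> X"
  and X_uminus: "x \<in> X \<Longrightarrow> - x \<in> X"
  and X_scale: "x \<in> X \<Longrightarrow> t *s x \<in> X"
  and X_sum: "(\<And>i. i \<in> I \<Longrightarrow> f i \<in> X) \<Longrightarrow> sum f I \<in> X"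
  using subspace_X subspace_0 subspace_add subspace_diff subspace_neg subspace_scale
    subspace_sum[of X I f]
  by auto

lemmas X_closed = X_0 X_add X_diff X_uminus X_scale X_sum

lemma N_0: "N 0 = 0"
proof -
  have "N 0 < \<epsilon>" if "0 < \<epsilon>" for \<epsilon>
    using absorbing[OF X_0 that] by (metis norm_zero scale_zero_right)
  then have "N 0 \<le> 0"
    by (meson less_irrefl not_le_imp_less)
  moreover have "N 0 \<ge> 0"
    using triangle[OF X_0 X_0] by simp
  ultimately show ?thesis by simp
qed

lemma nonneg: "x \<in> X \<Longrightarrow> 0 \<le> N x"
  using balanced[of x 0] by (simp add: N_0)

lemma uminus: "x \<in> X \<Longrightarrow> N (- x) = N x"
  using balanced[of x "-1"] balanced[of "- x" "-1"] X_uminus[of x] by simp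

lemma minus_commute: "x \<in> X \<Longrightarrow> y \<in> X \<Longrightarrow> N (x - y) = N (y - x)"
  using uminus[of "x - y"] X_diff by simp

lemma triangle_diff: "x \<in> X \<Longrightarrow> y \<in> X \<Longrightarrow> N (x - y) \<le> N x + N y"
  using triangle[of x "- y"] uminus[of y] X_uminus[of y] by simp

lemma triangle_sub: "x \<in> X \<Longrightarrow> y \<in> X \<Longrightarrow> N x \<le> N y + N (x - y)"
  using triangle[of y "x - y"] X_diff by simp

lemma triangle_sum:
  assumes "\<And>i. i \<in> I \<Longrightarrow> f i \<in> X"
  shows "N (sum f I) \<le> (\<Sum>i\<in>I. N (f i))"
proof (cases "finite I")
  case True
  then show ?thesis using assms
  proof (induction I)
    case (insert i I)
    have "N (f i + sum f I) \<le> N (f i) + N (sum f I)"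
      using insert by (intro triangle X_sum) auto
    also have "\<dots> \<le> N (f i) + (\<Sum>i\<in>I. N (f i))"
      using insert by simp
    finally show ?case using insert by simp
  qed (simp add: N_0)
qed (simp add: N_0)

lemma balanced_mono:
  assumes "x \<in> X" "norm s \<le> norm t" shows "N (s *s x) \<le> N (t *s x)"
proof (cases "t = 0")
  case False
  then show ?thesis
    using balanced[of "t *s x" "s / t"] assms X_scale[of x t] by (simp add: norm_divide)
qed (use assms in simp)

text \<open>Subadditivity in place of homogeneity: a large scalar is first bounded by an integer,
  and this lemma then controls the scaled-up vector.\<close>

lemma scale_numeral_le: "x \<in> X \<Longrightarrow> N (of_nat n *s x) \<le> of_nat n * N x"
proof (induction n)
  case (Suc n)
  have "N (x + of_nat n *s x) \<le> N x + N (of_nat n *s x)"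
    using Suc by (intro triangle X_scale)
  with Suc show ?case by (simp add: scale_left_distrib algebra_simps)
qed (simp add: N_0)

lemma sum_scale_tendsto_0:
  fixes n :: nat
  assumes "\<And>i. i < n \<Longrightarrow> e i \<in> X" and "\<And>i. i < n \<Longrightarrow> (\<lambda>j. c j i) \<longlonglongrightarrow> 0"
  shows "(\<lambda>j. N (\<Sum>i<n. c j i *s e i)) \<longlonglongrightarrow> 0"
proof (rule tendsto_sandwich[OF _ _ tendsto_const])
  show "\<forall>\<^sub>F j in sequentially. N (\<Sum>i<n. c j i *s e i) \<le> (\<Sum>i<n. N (c j i *s e i))"
    using assms by (intro always_eventually allI triangle_sum X_scale) auto
  show "(\<lambda>j. \<Sum>i<n. N (c j i *s e i)) \<longlonglongrightarrow> 0"
  proof (intro tendsto_null_sum)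
    fix i assume i: "i \<in> {..<n}"
    show "(\<lambda>j. N (c j i *s e i)) \<longlonglongrightarrow> 0"
    proof (rule tendstoI)
      fix \<epsilon> :: real assume "0 < \<epsilon>"
      then obtain r where r: "r > 0" "\<And>t. norm t < r \<Longrightarrow> N (t *s e i) < \<epsilon>"
        using absorbing assms i by (metis lessThan_iff)
      have "\<forall>\<^sub>F j in sequentially. norm (c j i) < r"
        using tendstoD[OF assms(2)[of i] r(1)] i by simp
      then show "\<forall>\<^sub>F j in sequentially. dist (N (c j i *s e i)) 0 < \<epsilon>"
        by eventually_elim (use r assms i in \<open>auto simp: nonneg X_scale\<close>)
    qed
  qed
  show "\<forall>\<^sub>F j in sequentially. 0 \<le> N (\<Sum>i<n. c j i *s e i)"
    using assms by (intro always_eventually allI nonneg X_closed) auto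
qed

text \<open>A finite net of the scalar unit disc, fine enough for \<open>absorbing\<close>, is
  combined with a net for the shorter box. Completeness of \<open>N\<close> does not enter, so the
  lemma can be applied to \<open>p\<close>.\<close>

lemma box_totally_bounded:
  fixes n :: nat
  assumes K: "compact (cball (0::'k) 1)" and "\<And>i. i < n \<Longrightarrow> e i \<in> X" and "0 < \<epsilon>"
  shows "\<exists>F. finite F \<and> F \<subseteq> X \<and>
    (\<forall>a. (\<forall>i<n. norm (a i) \<le> 1) \<longrightarrow> (\<exists>y\<in>F. N ((\<Sum>i<n. a i *s e i) - y) < \<epsilon>))"
  using assms(2,3)
proof (induction n arbitrary: \<epsilon>)
  case 0
  then show ?case by (intro exI[of _ "{0}"]) (auto simp: N_0 X_0)
next
  case (Suc n)
  obtain F where F: "finite F" "F \<subseteq> X"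
    "\<And>a. \<forall>i<n. norm (a i) \<le> 1 \<Longrightarrow> \<exists>y\<in>F. N ((\<Sum>i<n. a i *s e i) - y) < \<epsilon> / 2"
    using Suc.IH[of "\<epsilon> / 2"] Suc.prems by force
  obtain r where r: "r > 0" "\<And>t. norm t < r \<Longrightarrow> N (t *s e n) < \<epsilon> / 2"
    using absorbing[of "e n" "\<epsilon> / 2"] Suc.prems by auto
  obtain T where T: "finite T" "cball (0::'k) 1 \<subseteq> (\<Union>t\<in>T. ball t r)"
    using K r(1) unfolding compact_eq_totally_bounded by blast
  let ?F = "(\<lambda>(y, t). y + t *s e n) ` (F \<times> T)"
  show ?case
  proof (intro exI[of _ ?F] conjI allI impI)
    show "finite ?F" using F T by auto
    show "?F \<subseteq> X" using F Suc.prems by (auto intro!: X_closed)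
    fix a :: "nat \<Rightarrow> 'k" assume a: "\<forall>i<Suc n. norm (a i) \<le> 1"
    then obtain y where y: "y \<in> F" "N ((\<Sum>i<n. a i *s e i) - y) < \<epsilon> / 2"
      using F(3)[of a] by auto
    have "a n \<in> cball 0 1" using a by simp
    then obtain t where t: "t \<in> T" "norm (a n - t) < r"
      using T by (auto simp: dist_norm norm_minus_commute)
    have "N (((\<Sum>i<n. a i *s e i) - y) + (a n - t) *s e n)
        \<le> N ((\<Sum>i<n. a i *s e i) - y) + N ((a n - t) *s e n)"
      using Suc.prems y F by (intro triangle X_closed) auto
    also have "\<dots> < \<epsilon>" using y r(2)[OF t(2)] by simp
    finally have "N ((\<Sum>i<Suc n. a i *s e i) - (y + t *s e n)) < \<epsilon>"
      by (simp add: algebra_simps scale_left_diff_distrib)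
    with y t show "\<exists>y\<in>?F. N ((\<Sum>i<Suc n. a i *s e i) - y) < \<epsilon>"
      by (intro bexI[of _ "y + t *s e n"]) auto
  qed
qed

end

section \<open>Complete F-norms and convergence of series\<close>

locale complete_F_norm = F_norm smul X N
  for smul :: "'k::real_or_complex \<Rightarrow> 'a::ab_group_add \<Rightarrow> 'a" (infixr "*s" 75) and X N +
  assumes complete: "range s \<subseteq> X \<Longrightarrow> (\<forall>\<epsilon>>0. \<exists>n. \<forall>j\<ge>n. \<forall>k\<ge>n. N (s j - s k) < \<epsilon>) \<Longrightarrow>
    \<exists>l\<in>X. (\<lambda>n. N (s n - l)) \<longlonglongrightarrow> 0"
begin

lemma summable_imp_convergent:
  assumes u: "\<And>n. u n \<in> X" and le: "\<And>n. N (u n) \<le> b n" and b: "summable b"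
  obtains l where "l \<in> X" "(\<lambda>n. N ((\<Sum>i<n. u i) - l)) \<longlonglongrightarrow> 0"
proof -
  have diff: "N ((\<Sum>i<k. u i) - (\<Sum>i<j. u i)) \<le> norm (\<Sum>i=j..<k. b i)" if "j \<le> k" for j k
  proof -
    have "(\<Sum>i<k. u i) - (\<Sum>i<j. u i) = (\<Sum>i=j..<k. u i)"
      using that by (simp add: sum_diff_nat_ivl lessThan_atLeast0)
    then have "N ((\<Sum>i<k. u i) - (\<Sum>i<j. u i)) \<le> (\<Sum>i=j..<k. N (u i))"
      using triangle_sum[of "{j..<k}" u] u by simp
    also have "\<dots> \<le> (\<Sum>i=j..<k. b i)" by (intro sum_mono le)
    finally show ?thesis by simp
  qed
  have "\<exists>n. \<forall>j\<ge>n. \<forall>k\<ge>n. N ((\<Sum>i<j. u i) - (\<Sum>i<k. u i)) < \<epsilon>" if "0 < \<epsilon>" for \<epsilon>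
  proof -
    obtain n where n: "\<And>j k. j \<ge> n \<Longrightarrow> norm (\<Sum>i=j..<k. b i) < \<epsilon>"
      using b \<open>0 < \<epsilon>\<close> unfolding summable_Cauchy by blast
    have "N ((\<Sum>i<j. u i) - (\<Sum>i<k. u i)) < \<epsilon>" if "j \<ge> n" "k \<ge> n" for j k
      using diff[of j k] diff[of k j] n[of j k] n[of k j] that
        minus_commute[OF X_sum X_sum, of "{..<j}" u "{..<k}" u] u
      by (cases "j \<le> k") force+
    then show ?thesis by blast
  qed
  moreover have "range (\<lambda>n. \<Sum>i<n. u i) \<subseteq> X"
    using u by (auto intro: X_sum)
  ultimately show thesis
    using complete[of "\<lambda>n. \<Sum>i<n. u i"] that by blast
qed

end

section \<open>Basic sequences from a weaker vector topology\<close>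

text \<open>\<open>\<U>\<close> is the set of open neighbourhoods of \<open>0\<close> in the weaker topology; nothing else of that
  topology is needed.\<close>

locale weaker_vector_topology = complete_F_norm smul X N
  for smul :: "'k::real_or_complex \<Rightarrow> 'a::ab_group_add \<Rightarrow> 'a" (infixr "*s" 75) and X N +
  fixes \<U> :: "'a set set"
  assumes X_nbhd: "X \<in> \<U>"
    and nbhd_subset: "U \<in> \<U> \<Longrightarrow> U \<subseteq> X"
    and nbhd_0: "U \<in> \<U> \<Longrightarrow> 0 \<in> U"
    and nbhd_Int: "U \<in> \<U> \<Longrightarrow> V \<in> \<U> \<Longrightarrow> U \<inter> V \<in> \<U>"
    and nbhd_add: "U \<in> \<U> \<Longrightarrow> \<exists>V\<in>\<U>. \<forall>x\<in>V. \<forall>y\<in>V. x + y \<in> U"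
    and nbhd_balanced: "U \<in> \<U> \<Longrightarrow> \<exists>V\<in>\<U>. \<forall>t x. norm t \<le> 1 \<longrightarrow> x \<in> V \<longrightarrow> t *s x \<in> U"
    and nbhd_separating: "(\<And>U. U \<in> \<U> \<Longrightarrow> x \<in> U) \<Longrightarrow> x = 0"
    and nbhd_weaker: "U \<in> \<U> \<Longrightarrow> \<exists>r>0. \<forall>x\<in>X. N x < r \<longrightarrow> x \<in> U"
    and nbhd_strict: "\<exists>r>0. \<forall>U\<in>\<U>. \<exists>x\<in>U. r \<le> N x"
begin

lemma nbhd_X: "U \<in> \<U> \<Longrightarrow> x \<in> U \<Longrightarrow> x \<in> X"
  using nbhd_subset by blast

lemma nbhd_INT: "finite F \<Longrightarrow> (\<And>y. y \<in> F \<Longrightarrow> V y \<in> \<U>) \<Longrightarrow> \<exists>W\<in>\<U>. \<forall>y\<in>F. W \<subseteq> V y"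
proof (induction F rule: finite_induct)
  case empty
  then show ?case using X_nbhd by blast
next
  case (insert y F)
  then obtain W where "W \<in> \<U>" "\<forall>y\<in>F. W \<subseteq> V y" by auto
  then show ?case using insert.prems nbhd_Int[of W "V y"] by blast
qed

text \<open>The lower semicontinuous envelope of \<open>N\<close> for the weaker topology: the \<open>p\<close>-balls are essentially
  the weak closures of the \<open>N\<close>-balls.\<close>

definition p :: "'a \<Rightarrow> real" where
  "p x = Inf {s. 0 < s \<and> (\<forall>U\<in>\<U>. \<exists>u\<in>U. N (x + u) < s)}"

lemma p_le: "0 < s \<Longrightarrow> (\<And>U. U \<in> \<U> \<Longrightarrow> \<exists>u\<in>U. N (x + u) < s) \<Longrightarrow> p x \<le> s"
  unfolding p_def by (intro cInf_lower bdd_belowI[of _ 0]) auto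

lemma p_nonempty: "x \<in> X \<Longrightarrow> N x < s \<Longrightarrow> s \<in> {s. 0 < s \<and> (\<forall>U\<in>\<U>. \<exists>u\<in>U. N (x + u) < s)}"
  using nonneg[of x] nbhd_0 by (auto intro!: bexI[of _ 0])

lemma p_less:
  assumes "x \<in> X" "p x < s" "U \<in> \<U>" shows "\<exists>u\<in>U. N (x + u) < s"
proof -
  let ?S = "{s. 0 < s \<and> (\<forall>U\<in>\<U>. \<exists>u\<in>U. N (x + u) < s)}"
  have "N x + 1 \<in> ?S"
    by (rule p_nonempty) (use assms in auto)
  then have "?S \<noteq> {}" by (metis empty_iff)
  moreover have "Inf ?S < s" using assms(2) by (simp only: p_def)
  ultimately obtain s' where s': "s' \<in> ?S" "s' < s"
    using cInf_lessD[of ?S s] by blast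
  then obtain u where "u \<in> U" "N (x + u) < s'"
    using assms(3) by auto
  with s' show ?thesis by (intro bexI[of _ u]) auto
qed

lemma p_nonneg: "x \<in> X \<Longrightarrow> 0 \<le> p x"
  unfolding p_def using p_nonempty[of x "N x + 1"] by (intro cInf_greatest) auto

lemma p_le_N: "x \<in> X \<Longrightarrow> p x \<le> N x"
proof (rule field_le_epsilon)
  fix \<epsilon> :: real assume "x \<in> X" "0 < \<epsilon>"
  then show "p x \<le> N x + \<epsilon>"
    using p_nonempty[of x "N x + \<epsilon>"] by (intro p_le) auto
qed

lemma p_triangle:
  assumes "x \<in> X" "y \<in> X" shows "p (x + y) \<le> p x + p y"
proof (rule field_le_epsilon)
  fix \<epsilon> :: real assume \<epsilon>: "0 < \<epsilon>"
  have "p (x + y) \<le> (p x + \<epsilon> / 2) + (p y + \<epsilon> / 2)"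
  proof (rule p_le)
    show "0 < p x + \<epsilon> / 2 + (p y + \<epsilon> / 2)" using p_nonneg[OF assms(1)] p_nonneg[OF assms(2)] \<epsilon> by linarith
    fix U assume "U \<in> \<U>"
    then obtain V where V: "V \<in> \<U>" "\<forall>x\<in>V. \<forall>y\<in>V. x + y \<in> U" using nbhd_add by blast
    obtain u v where uv: "u \<in> V" "N (x + u) < p x + \<epsilon> / 2" "v \<in> V" "N (y + v) < p y + \<epsilon> / 2"
      using p_less[OF assms(1) _ V(1), of "p x + \<epsilon> / 2"]
        p_less[OF assms(2) _ V(1), of "p y + \<epsilon> / 2"] \<epsilon> by auto
    have "N ((x + u) + (y + v)) \<le> N (x + u) + N (y + v)"
      using assms uv V nbhd_X by (intro triangle X_closed)
    moreover have "(x + u) + (y + v) = (x + y) + (u + v)" by (simp add: algebra_simps)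
    ultimately show "\<exists>u\<in>U. N (x + y + u) < p x + \<epsilon> / 2 + (p y + \<epsilon> / 2)"
      using uv V by (intro bexI[of _ "u + v"]) auto
  qed
  then show "p (x + y) \<le> p x + p y + \<epsilon>" by simp
qed

lemma p_balanced:
  assumes "x \<in> X" "norm t \<le> 1" shows "p (t *s x) \<le> p x"
proof (rule field_le_epsilon)
  fix \<epsilon> :: real assume \<epsilon>: "0 < \<epsilon>"
  show "p (t *s x) \<le> p x + \<epsilon>"
  proof (rule p_le)
    show "0 < p x + \<epsilon>" using p_nonneg[OF assms(1)] \<epsilon> by linarith
    fix U assume "U \<in> \<U>"
    then obtain V where V: "V \<in> \<U>" "\<forall>t x. norm t \<le> 1 \<longrightarrow> x \<in> V \<longrightarrow> t *s x \<in> U"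
      using nbhd_balanced by blast
    obtain u where u: "u \<in> V" "N (x + u) < p x + \<epsilon>"
      using p_less[OF assms(1) _ V(1), of "p x + \<epsilon>"] \<epsilon> by auto
    have "N (t *s (x + u)) \<le> N (x + u)"
      using assms u V nbhd_X by (intro balanced X_closed)
    then show "\<exists>u\<in>U. N (t *s x + u) < p x + \<epsilon>"
      using u V assms by (intro bexI[of _ "t *s u"]) (auto simp: scale_right_distrib)
  qed
qed

text \<open>Write \<open>x\<close> as \<open>(x + u) - u\<close> with \<open>u\<close> weakly small
  and \<open>x + u\<close> small for \<open>N\<close>. Together with \<open>nbhd_separating\<close>
  this makes \<open>p\<close> definite.\<close>

lemma p_nbhd:
  assumes "U \<in> \<U>" shows "\<exists>r>0. \<forall>x\<in>X. p x < r \<longrightarrow> x \<in> U"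
proof -
  obtain V where V: "V \<in> \<U>" "\<forall>x\<in>V. \<forall>y\<in>V. x + y \<in> U" using nbhd_add assms by blast
  obtain V' where V': "V' \<in> \<U>" "\<forall>t x. norm t \<le> 1 \<longrightarrow> x \<in> V' \<longrightarrow> t *s x \<in> V"
    using nbhd_balanced V by blast
  obtain r where r: "r > 0" "\<And>x. x \<in> X \<Longrightarrow> N x < r \<Longrightarrow> x \<in> V" using nbhd_weaker V by metis
  have "x \<in> U" if x: "x \<in> X" "p x < r" for x
  proof -
    obtain u where u: "u \<in> V'" "N (x + u) < r" using p_less[OF x V'(1)] by blast
    then have "x + u \<in> V" using r(2) X_add x(1) nbhd_X V'(1) by blast
    moreover have "- u \<in> V" using V'(2)[rule_format, of "-1" u] u by simp
    ultimately have "(x + u) + - u \<in> U" using V by blast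
    then show ?thesis by simp
  qed
  then show ?thesis using r by blast
qed

sublocale p: F_norm smul X p
proof
  show "x = 0" if "x \<in> X" "p x = 0" for x
    by (rule nbhd_separating) (use p_nbhd that in force)
  show "\<exists>r>0. \<forall>t. norm t < r \<longrightarrow> p (t *s x) < \<epsilon>" if "x \<in> X" "0 < \<epsilon>" for x \<epsilon>
    using absorbing[OF that] p_le_N X_scale that by (meson le_less_trans)
qed (auto intro: subspace_X p_triangle p_balanced)

text \<open>Some single neighbourhood \<open>U\<close> already witnesses that \<open>x\<close> is
  not weakly approximated by the \<open>N\<close>-ball of radius \<open>p x - \<epsilon>\<close>. If
  \<open>V + V\<close> lies in \<open>U\<close>, then \<open>V\<close> witnesses the same for every
  \<open>x + v\<close> with \<open>v\<close> in \<open>V\<close>.\<close>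

lemma p_lsc:
  assumes x: "x \<in> X" and \<epsilon>: "0 < \<epsilon>"
  shows "\<exists>V\<in>\<U>. \<forall>v\<in>V. p x - \<epsilon> \<le> p (x + v)"
proof (cases "p x - \<epsilon> \<le> 0")
  case True
  then show ?thesis
    using X_nbhd p_nonneg x X_add by (meson order_trans)
next
  case False
  then obtain U where U: "U \<in> \<U>" "\<And>u. u \<in> U \<Longrightarrow> p x - \<epsilon> \<le> N (x + u)"
    using p_le[of "p x - \<epsilon>" x] \<epsilon> by force
  obtain V where V: "V \<in> \<U>" "\<forall>x\<in>V. \<forall>y\<in>V. x + y \<in> U" using nbhd_add U by blast
  have "p x - \<epsilon> \<le> p (x + v)" if v: "v \<in> V" for v
  proof (rule ccontr)
    assume "\<not> ?thesis"
    then obtain w where w: "w \<in> V" "N (x + v + w) < p x - \<epsilon>"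
      using p_less[of "x + v" "p x - \<epsilon>" V] V v x nbhd_X X_add by force
    with U(2)[of "v + w"] V v show False by (simp add: add.assoc)
  qed
  then show ?thesis using V by blast
qed

text \<open>This is the successive approximation step of the open mapping theorem: if every \<open>p\<close>-ball
  were a neighbourhood in the weaker topology, the two topologies would coincide.\<close>

lemma p_strict: "\<exists>\<delta>>0. \<forall>U\<in>\<U>. \<exists>x\<in>U. \<delta> \<le> p x"
proof (rule ccontr)
  assume "\<not> ?thesis"
  then have small: "\<exists>U\<in>\<U>. \<forall>u\<in>U. p u < \<delta>" if "0 < \<delta>" for \<delta>
    using that by (meson not_le_imp_less)
  have N_le: "N x \<le> 2 * s" if x: "x \<in> X" "p x < s" for x s
  proof -
    have s: "0 < s" using p_nonneg[OF x(1)] x(2) by simp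
    \<comment> \<open>\<open>y n\<close> is the remainder of \<open>x\<close> after \<open>n\<close>
      corrections: it is small for \<open>p\<close>, whereas the correction
      \<open>y n - y (Suc n)\<close> is small for \<open>N\<close>.\<close>
    define P where "P n y \<longleftrightarrow> y \<in> X \<and> p y < s / 2 ^ n \<and> (n = 0 \<longrightarrow> y = x)" for n y
    have "\<exists>y. \<forall>n. P n (y n) \<and> N (y n - y (Suc n)) < s / 2 ^ n"
    proof (rule dependent_nat_choice)
      show "\<exists>y. P 0 y" using x by (simp add: P_def)
      fix y n assume y: "P n y"
      obtain U where U: "U \<in> \<U>" "\<forall>u\<in>U. p u < s / 2 ^ Suc n" using small[of "s / 2 ^ Suc n"] s by auto
      obtain u where u: "u \<in> U" "N (y + u) < s / 2 ^ n" using p_less[OF _ _ U(1)] y by (auto simp: P_def)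
      have "u \<in> X" using u U nbhd_X by blast
      \<comment> \<open>The next remainder is \<open>- u\<close>: the correction
        \<open>y + u\<close> is small for \<open>N\<close>, and \<open>u\<close> comes from a
        neighbourhood on which \<open>p\<close> is below \<open>s / 2 ^ Suc n\<close>.\<close>
      then show "\<exists>z. P (Suc n) z \<and> N (y - z) < s / 2 ^ n"
        using u U by (intro exI[of _ "- u"]) (auto simp: P_def X_uminus p.uminus)
    qed
    then obtain y where "\<And>n. P n (y n)" and dy: "\<And>n. N (y n - y (Suc n)) < s / 2 ^ n" by blast
    then have y: "\<And>n. y n \<in> X" "\<And>n. p (y n) < s / 2 ^ n" "y 0 = x" by (auto simp: P_def)
    have geo: "(\<lambda>n. s / 2 ^ n) sums (2 * s)"
      using sums_mult[OF geometric_sums[of "1/2::real"], of s] by (simp add: power_one_over mult.commute[of _ s])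
    have tele: "(\<Sum>i<n. y i - y (Suc i)) = x - y n" for n
      using sum_lessThan_telescope'[of y n] y by simp
    obtain l where l: "l \<in> X" "(\<lambda>n. N (x - y n - l)) \<longlonglongrightarrow> 0"
      using summable_imp_convergent[of "\<lambda>n. y n - y (Suc n)" "\<lambda>n. s / 2 ^ n"] y dy geo
      unfolding tele by (metis X_diff less_imp_le sums_summable)
    have "(\<lambda>n. s / 2 ^ n) \<longlonglongrightarrow> 0" using geo by (meson sums_summable summable_LIMSEQ_zero)
    then have "(\<lambda>n. s / 2 ^ n + N (x - y n - l)) \<longlonglongrightarrow> 0"
      using tendsto_add_zero l(2) by blast
    \<comment> \<open>The corrections sum to \<open>l\<close> in \<open>N\<close> and the remainders
      tend to 0 in \<open>p\<close>. As \<open>p\<close> is at most \<open>N\<close> and definite,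
      \<open>l = x\<close>, so the remainders tend to 0 in \<open>N\<close> too.\<close>
    moreover have "p (x - l) \<le> s / 2 ^ n + N (x - y n - l)" for n
    proof -
      have "p (x - l) \<le> p (y n) + p (x - l - y n)"
        using x y l by (intro p.triangle_sub X_closed)
      also have "\<dots> \<le> s / 2 ^ n + N (x - l - y n)"
        using x y(1,2) l by (intro add_mono p_le_N X_closed) (auto simp: less_imp_le)
      finally show ?thesis by (simp add: algebra_simps)
    qed
    ultimately have "p (x - l) \<le> 0" by (meson LIMSEQ_le_const)
    then have "x - l = 0" using x l X_diff p.eq_0 p_nonneg by (metis order_antisym)
    then have "(\<lambda>n. N (y n)) \<longlonglongrightarrow> 0" using l(2) y by (simp add: uminus)
    then have lim: "(\<lambda>n. N (y n) + 2 * s) \<longlonglongrightarrow> 0 + 2 * s" by (intro tendsto_intros)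
    have "N x \<le> N (y n) + 2 * s" for n
    proof -
      have "N (x - y n) \<le> (\<Sum>i<n. N (y i - y (Suc i)))"
        unfolding tele[symmetric] using y by (intro triangle_sum X_closed)
      also have "\<dots> \<le> (\<Sum>i<n. s / 2 ^ i)" by (intro sum_mono less_imp_le dy)
      also have "\<dots> \<le> 2 * s" using sum_le_suminf[OF sums_summable[OF geo], of "{..<n}"] s geo
        by (simp add: sums_iff)
      finally show ?thesis using triangle_sub[OF x(1) y(1)[of n]] by simp
    qed
    then have "N x \<le> 0 + 2 * s" by (intro LIMSEQ_le_const[OF lim]) auto
    then show ?thesis by simp
  qed
  obtain r where r: "r > 0" "\<forall>U\<in>\<U>. \<exists>x\<in>U. r \<le> N x" using nbhd_strict by blast
  \<comment> \<open>\<open>N_le\<close> doubles the radius; with a third of \<open>r\<close> the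
    result \<open>2 * (r / 3)\<close> is still below \<open>r\<close>.\<close>
  obtain U where U: "U \<in> \<U>" "\<forall>u\<in>U. p u < r / 3" using small[of "r / 3"] r by auto
  obtain x where "x \<in> U" "r \<le> N x" using r U by blast
  moreover have "N x \<le> 2 * (r / 3)" using calculation U nbhd_X by (intro N_le) auto
  ultimately show False using r(1) by linarith
qed

text \<open>The box spanned by the previous vectors is totally bounded, so finitely many applications of
  lower semicontinuity give one weak neighbourhood from which \<open>y\<close> may be taken.\<close>

lemma next_basis_vector:
  fixes n :: nat
  assumes K: "compact (cball (0::'k) 1)" and e: "\<And>i. i < n \<Longrightarrow> e i \<in> X" and \<epsilon>: "0 < \<epsilon>"
    and \<delta>: "\<forall>U\<in>\<U>. \<exists>x\<in>U. \<delta> \<le> p x"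
  shows "\<exists>y\<in>X. \<delta> \<le> p y \<and> (\<forall>a c. (\<forall>i<n. norm (a i) \<le> 1) \<longrightarrow> norm c \<le> 1 \<longrightarrow>
    p (\<Sum>i<n. a i *s e i) \<le> p ((\<Sum>i<n. a i *s e i) + c *s y) + \<epsilon>)"
proof -
  \<comment> \<open>Three errors of at most \<open>\<epsilon> / 4\<close> will occur: the net point
    replaces the box point once without and once with \<open>c *s y\<close>, and semicontinuity is
    used once at the net point.\<close>
  obtain F where F: "finite F" "F \<subseteq> X"
    "\<And>a. \<forall>i<n. norm (a i) \<le> 1 \<Longrightarrow> \<exists>z\<in>F. p ((\<Sum>i<n. a i *s e i) - z) < \<epsilon> / 4"
    using p.box_totally_bounded[where e = e and n = n and \<epsilon> = "\<epsilon> / 4", OF K e] \<epsilon> by auto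
  have "\<forall>z\<in>F. \<exists>V\<in>\<U>. \<forall>v\<in>V. p z - \<epsilon> / 4 \<le> p (z + v)"
    using p_lsc F \<epsilon> by (meson divide_pos_pos subsetD zero_less_numeral)
  then obtain V where V: "\<And>z. z \<in> F \<Longrightarrow> V z \<in> \<U>"
    "\<And>z v. z \<in> F \<Longrightarrow> v \<in> V z \<Longrightarrow> p z - \<epsilon> / 4 \<le> p (z + v)" by metis
  obtain W where W: "W \<in> \<U>" "\<forall>z\<in>F. W \<subseteq> V z" using nbhd_INT[OF F(1), of V] V(1) by blast
  \<comment> \<open>Thanks to this shrinking one vector \<open>y\<close> serves all \<open>c\<close>
    in the unit disc.\<close>
  obtain W' where W': "W' \<in> \<U>" "\<forall>t x. norm t \<le> 1 \<longrightarrow> x \<in> W' \<longrightarrow> t *s x \<in> W"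
    using nbhd_balanced W by blast
  obtain y where y: "y \<in> W'" "\<delta> \<le> p y" using \<delta> W' by blast
  have yX: "y \<in> X" using y W' nbhd_X by blast
  show ?thesis
  proof (intro bexI[of _ y] conjI allI impI y yX)
    fix a :: "nat \<Rightarrow> 'k" and c :: 'k
    assume a: "\<forall>i<n. norm (a i) \<le> 1" and c: "norm c \<le> 1"
    let ?x = "\<Sum>i<n. a i *s e i"
    obtain z where z: "z \<in> F" "p (?x - z) < \<epsilon> / 4" using F(3)[OF a] by blast
    have X: "?x \<in> X" "z \<in> X" "c *s y \<in> X" using e z F yX by (auto intro!: X_closed)
    have "c *s y \<in> V z" using W W' y c z by blast
    then have "p z - \<epsilon> / 4 \<le> p (z + c *s y)" using V z by blast
    moreover have "p (z + c *s y) \<le> p (?x + c *s y) + p (z + c *s y - (?x + c *s y))"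
      using X by (intro p.triangle_sub X_add)
    moreover have "p (z + c *s y - (?x + c *s y)) = p (?x - z)"
      using p.minus_commute[OF X(1,2)] by simp
    moreover have "p ?x \<le> p z + p (?x - z)" using X by (intro p.triangle_sub)
    ultimately show "p ?x \<le> p (?x + c *s y) + \<epsilon>" using z \<epsilon> by linarith
  qed
qed

end

section \<open>Basic sequences with respect to the envelope\<close>

context F_norm
begin

text \<open>Needed for the intermediate value theorem: since \<open>N\<close> is not homogeneous,
  the factor that brings a vector to a prescribed value cannot be written down.\<close>

lemma continuous_on_scale:
  assumes x: "x \<in> X" shows "continuous_on S (\<lambda>s::real. N (of_real s *s x))"
  unfolding continuous_on_iff
proof (intro ballI allI impI)
  fix s \<epsilon> :: real assume "0 < \<epsilon>"
  then obtain r where r: "r > 0" "\<And>t. norm t < r \<Longrightarrow> N (t *s x) < \<epsilon>"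
    using absorbing x by metis
  show "\<exists>d>0. \<forall>t\<in>S. dist t s < d \<longrightarrow> dist (N (of_real t *s x)) (N (of_real s *s x)) < \<epsilon>"
  proof (intro exI[of _ r] conjI ballI impI r(1))
    fix t assume "dist t s < r"
    then have *: "norm (of_real (t - s) :: 'k) < r" "norm (of_real (s - t) :: 'k) < r"
      by (simp_all only: norm_of_real dist_real_def abs_minus_commute)
    have eq: "of_real (u - v) *s x = of_real u *s x - of_real v *s x" for u v :: real
      by (simp add: scale_left_diff_distrib)
    show "dist (N (of_real t *s x)) (N (of_real s *s x)) < \<epsilon>"
      using triangle_sub[OF X_scale X_scale, OF x x, of "of_real t" "of_real s"] r(2)[OF *(1)]
        triangle_sub[OF X_scale X_scale, OF x x, of "of_real s" "of_real t"] r(2)[OF *(2)]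
      unfolding eq dist_real_def by linarith
  qed
qed

end

context weaker_vector_topology
begin

text \<open>The thresholds \<open>\<theta> n\<close> decrease slightly with \<open>n\<close>, which absorbs the errors of the successive
  choices in the induction bounding the coefficients.\<close>

lemma basic_sequence_p:
  assumes K: "compact (cball (0::'k) 1)"
  obtains e \<delta> where "0 < \<delta>" "range e \<subseteq> X"
    "\<And>(n::nat) a. p (\<Sum>i<n. a i *s e i) \<le> \<delta> \<Longrightarrow> \<forall>i<n. norm (a i) \<le> 1"
    "\<And>(n::nat) m a. n \<le> m \<Longrightarrow> p (\<Sum>i<m. a i *s e i) \<le> \<delta> \<Longrightarrow>
      p (\<Sum>i<n. a i *s e i) \<le> p (\<Sum>i<m. a i *s e i) + \<delta> / 2 ^ n"
proof -
  obtain D where D: "D > 0" "\<forall>U\<in>\<U>. \<exists>x\<in>U. D \<le> p x" using p_strict by blast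
  \<comment> \<open>Two successive partial sums of value at most \<open>2 * \<delta>\<close> differ
    by at most \<open>4 * \<delta> = D / 2\<close>, which is less than \<open>p (e n)\<close>. Hence
    the last coefficient cannot exceed 1.\<close>
  define \<delta> where "\<delta> = D / 8"
  define \<theta> where "\<theta> n = \<delta> + \<delta> / 2 ^ n" for n :: nat
  define P where "P e n y \<longleftrightarrow> y \<in> X \<and> D \<le> p y \<and>
    (\<forall>a c. (\<forall>i<n. norm (a i) \<le> 1) \<longrightarrow> norm c \<le> 1 \<longrightarrow>
      p (\<Sum>i<n. a i *s e i) \<le> p ((\<Sum>i<n. a i *s e i) + c *s y) + \<delta> / 4 / 2 ^ n)"
    for e and n :: nat and y
  have \<delta>: "\<delta> > 0" using D by (simp add: \<delta>_def)
  have "\<exists>e. \<forall>n. P e n (e n)"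
  proof (rule dependent_wellorder_choice)
    show "P f n y \<longleftrightarrow> P g n y" if "\<And>i. i < n \<Longrightarrow> f i = g i" for y f g n
    proof -
      have "(\<Sum>i<n. a i *s f i) = (\<Sum>i<n. a i *s g i)" for a using that by simp
      then show ?thesis by (simp add: P_def)
    qed
    show "\<exists>y. P e n y" if "\<And>i. i < n \<Longrightarrow> P e i (e i)" for n e
      using next_basis_vector[OF K, of n e "\<delta> / 4 / 2 ^ n" D] that \<delta> D by (auto simp: P_def)
  qed
  then obtain e where Pe: "\<And>n. P e n (e n)" by blast
  define S where "S a n = (\<Sum>i<n. a i *s e i)" for a and n :: nat
  have e: "e n \<in> X" "D \<le> p (e n)" for n using Pe[of n] by (auto simp: P_def)
  have S_X: "S a n \<in> X" for a n using e by (auto simp: S_def intro!: X_closed)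
  have S_Suc: "S a (Suc n) = S a n + a n *s e n" for a n by (simp add: S_def)
  have S_scale: "S (\<lambda>i. t * a i) n = t *s S a n" for t a n
    by (simp add: S_def scale_sum_right)
  have one_step: "p (S a n) \<le> p (S a (Suc n)) + \<delta> / 4 / 2 ^ n" if "\<forall>i<Suc n. norm (a i) \<le> 1" for a n
    using Pe[of n] that unfolding P_def S_Suc S_def by simp
  \<comment> \<open>The threshold drops by twice the error of \<open>one_step\<close>; the spare
    copy of the error produces the contradiction in \<open>coeff\<close>.\<close>
  have \<theta>_Suc: "\<theta> n = \<theta> (Suc n) + 2 * (\<delta> / 4 / 2 ^ n)" for n by (simp add: \<theta>_def)
  have \<theta>_le: "\<theta> n \<le> 2 * \<delta>" for n using \<delta> by (simp add: \<theta>_def field_simps)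
  have coeff_last: "norm (a n) \<le> 1" if "p (S a n) \<le> \<theta> n" "p (S a (Suc n)) \<le> \<theta> (Suc n)" for a n
  proof (rule ccontr)
    assume "\<not> ?thesis"
    then have "p (e n) \<le> p (a n *s e n)"
      using p.balanced_mono[OF e(1), of 1 "a n"] by simp
    also have "\<dots> \<le> p (S a (Suc n)) + p (S a n)"
      using p.triangle_diff[OF S_X S_X, of a "Suc n" a n] by (simp add: S_Suc)
    also have "\<dots> \<le> 4 * \<delta>" using that \<theta>_le[of n] \<theta>_le[of "Suc n"] by linarith
    finally show False using e(2)[of n] \<delta> by (simp add: \<delta>_def)
  qed
  have coeff: "\<forall>i<n. norm (a i) \<le> 1" if "p (S a n) \<le> \<theta> n" for a n
    using that
  proof (induction n arbitrary: a)
    case (Suc n)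
    show ?case
    proof (cases "p (S a n) \<le> \<theta> n")
      case True
      then show ?thesis using Suc coeff_last by (auto simp: less_Suc_eq)
    next
      case False
      \<comment> \<open>Shrink \<open>a\<close> until the head has value exactly
        \<open>\<theta> n\<close>. Then the induction hypothesis and \<open>coeff_last\<close>
        apply, and \<open>one_step\<close> would make twice its error at most the error
        itself.\<close>
      have "\<exists>s\<ge>0. s \<le> 1 \<and> p (of_real s *s S a n) = \<theta> n"
      proof (rule IVT')
        show "p (of_real 0 *s S a n) \<le> \<theta> n" using \<delta> by (simp add: p.N_0 \<theta>_def)
        show "\<theta> n \<le> p (of_real 1 *s S a n)" using False by simp
        show "continuous_on {0..1} (\<lambda>s. p (of_real s *s S a n))"
          by (intro p.continuous_on_scale S_X)
      qed simp
      then obtain s where s: "0 \<le> s" "s \<le> 1" "p (of_real s *s S a n) = \<theta> n" by blast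
      let ?b = "\<lambda>i. of_real s * a i"
      have 1: "p (S ?b n) = \<theta> n" using s by (simp add: S_scale)
      have 2: "p (S ?b (Suc n)) \<le> \<theta> (Suc n)"
        using Suc.prems p.balanced[OF S_X, of "of_real s" a "Suc n"] s by (simp add: S_scale)
      have "\<forall>i<Suc n. norm (?b i) \<le> 1"
        using Suc.IH[of ?b] coeff_last[of ?b n] 1 2 by (auto simp: less_Suc_eq)
      from one_step[OF this] 1 2 \<theta>_Suc[of n] have "2 * (\<delta> / 4 / 2 ^ n) \<le> \<delta> / 4 / 2 ^ n" by linarith
      with \<delta> show ?thesis by (simp add: field_simps)
    qed
  qed simp
  \<comment> \<open>The errors of \<open>one_step\<close> at \<open>n, ..., m - 1\<close> sum to the
    stated geometric difference.\<close>
  have mono: "p (S a n) \<le> p (S a m) + \<delta> / 2 * (1 / 2 ^ n - 1 / 2 ^ m)"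
    if "n \<le> m" "p (S a m) \<le> \<theta> m" for a n m
    using that
  proof (induction m rule: dec_induct)
    case (step m)
    have le: "p (S a m) \<le> p (S a (Suc m)) + \<delta> / 4 / 2 ^ m"
      by (intro one_step coeff step.prems)
    moreover have "p (S a m) \<le> \<theta> m"
      using le step.prems \<theta>_Suc[of m] \<delta> by (smt (verit) divide_pos_pos zero_less_power)
    moreover have "\<delta> / 4 / 2 ^ m + \<delta> / 2 * (1 / 2 ^ n - 1 / 2 ^ m) = \<delta> / 2 * (1 / 2 ^ n - 1 / 2 ^ Suc m)"
      by (simp add: field_simps)
    ultimately show ?case
      using step.IH by linarith
  qed simp
  show thesis
  proof (rule that[of \<delta> e])
    have le: "\<delta> \<le> \<theta> n" for n using \<delta> by (simp add: \<theta>_def)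
    show "\<forall>i<n. norm (a i) \<le> 1" if "p (\<Sum>i<n. a i *s e i) \<le> \<delta>" for n :: nat and a
      using coeff[of a n] order_trans[OF that le] unfolding S_def by blast
    show "p (\<Sum>i<n. a i *s e i) \<le> p (\<Sum>i<m. a i *s e i) + \<delta> / 2 ^ n"
      if "n \<le> m" "p (\<Sum>i<m. a i *s e i) \<le> \<delta>" for n m :: nat and a
    proof -
      have "\<delta> / 2 * (1 / 2 ^ n - 1 / 2 ^ m) \<le> \<delta> * (1 / 2 ^ n)"
        using \<delta> that by (intro mult_mono) (auto intro!: divide_left_mono power_increasing)
      then show ?thesis using mono[OF that(1), of a, OF order_trans[OF that(2)[folded S_def] le]] unfolding S_def
        by (simp only: mult_1_right times_divide_eq_right)
    qed
  qed (use \<delta> e in auto)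
qed

text \<open>Since \<open>p\<close> is at most \<open>N\<close>, bounds in \<open>N\<close> can be
  read in \<open>p\<close>. The last clause is uniqueness of expansions in a form suited to limits:
  compare late finite combinations with a fixed late one. Near monotonicity bounds the head of
  length \<open>n\<close> of the difference; the heads of the moving combinations vanish in the
  limit, which bounds the fixed one, and then \<open>n\<close> tends to infinity.\<close>

lemma basic_sequence:
  assumes K: "compact (cball (0::'k) 1)"
  obtains e \<delta> where "0 < \<delta>" "range e \<subseteq> X"
    "\<And>(n::nat) a. N (\<Sum>i<n. a i *s e i) \<le> \<delta> \<Longrightarrow> \<forall>i<n. norm (a i) \<le> 1"
    "\<forall>a (m :: nat \<Rightarrow> nat) w. (\<forall>j. \<forall>i\<ge>m j. a j i = 0) \<longrightarrow> w \<in> X \<longrightarrow>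
      (\<lambda>j. N ((\<Sum>i<m j. a j i *s e i) - w)) \<longlonglongrightarrow> 0 \<longrightarrow>
      (\<forall>i. (\<lambda>j. a j i) \<longlonglongrightarrow> 0) \<longrightarrow> w = 0"
proof -
  obtain e \<delta> where \<delta>: "0 < \<delta>" and e: "range e \<subseteq> X"
    and coeff: "\<And>(n::nat) a. p (\<Sum>i<n. a i *s e i) \<le> \<delta> \<Longrightarrow> \<forall>i<n. norm (a i) \<le> 1"
    and mono: "\<And>(n::nat) m a. n \<le> m \<Longrightarrow> p (\<Sum>i<m. a i *s e i) \<le> \<delta> \<Longrightarrow>
      p (\<Sum>i<n. a i *s e i) \<le> p (\<Sum>i<m. a i *s e i) + \<delta> / 2 ^ n"
    by (rule basic_sequence_p[OF K]) (rule that)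
  define S where "S a n = (\<Sum>i<n. a i *s e i)" for a and n :: nat
  have S_X: "S a n \<in> X" for a n using e by (auto simp: S_def intro!: X_closed)
  have S_diff: "S (\<lambda>i. a i - b i) n = S a n - S b n" for a b n
    by (simp add: S_def scale_left_diff_distrib sum_subtractf)
  have zero: "w = 0" if m: "\<And>j i. m j \<le> i \<Longrightarrow> a j i = 0" and w: "w \<in> X"
    and lim: "(\<lambda>j. N (S (a j) (m j) - w)) \<longlonglongrightarrow> 0" and a: "\<And>i. (\<lambda>j. a j i) \<longlonglongrightarrow> 0"
    for a and m :: "nat \<Rightarrow> nat" and w
  proof -
    define W where "W j = S (a j) (m j)" for j
    have W_X: "W j \<in> X" for j by (simp add: W_def S_X)
    have W_eq: "S (a j) n = W j" if "m j \<le> n" for j n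
      unfolding W_def S_def using that m by (intro sum.mono_neutral_right) auto
    have "p w \<le> 2 * \<eta>" if \<eta>: "0 < \<eta>" "\<eta> \<le> \<delta>" for \<eta>
    proof -
      have "\<forall>\<^sub>F j in sequentially. N (W j - w) < \<eta> / 2"
        using order_tendstoD(2)[OF lim, of "\<eta> / 2"] \<eta> by (simp add: W_def)
      then obtain J where "\<And>j. j \<ge> J \<Longrightarrow> N (W j - w) < \<eta> / 2"
        unfolding eventually_sequentially by blast
      then have J: "p (W j - w) < \<eta> / 2" if "j \<ge> J" for j
        using p_le_N[OF X_diff[OF W_X w]] that by (meson le_less_trans)
      have "p (W J) \<le> p (S (a j) n) + (\<eta> + \<delta> / 2 ^ n)" if "m J \<le> n" "J \<le> j" for n j
      proof -
        \<comment> \<open>Length \<open>M\<close> exhausts both combinations, so the sum up to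
          \<open>M\<close> is all of \<open>W j - W J\<close>, whereas the sum up to
          \<open>n\<close> contains all of \<open>W J\<close> but only a head of
          \<open>W j\<close>.\<close>
        define M where "M = max n (m j)"
        have "p ((W j - w) - (W J - w)) \<le> p (W j - w) + p (W J - w)"
          using W_X w by (intro p.triangle_diff X_diff)
        with J[of j] J[of J] that have le: "p (W j - W J) \<le> \<eta>" by simp
        have eq: "S (\<lambda>i. a j i - a J i) M = W j - W J"
          using that by (simp add: S_diff W_eq M_def)
        have "p (S (\<lambda>i. a j i - a J i) n) \<le> p (S (\<lambda>i. a j i - a J i) M) + \<delta> / 2 ^ n"
          unfolding S_def using le \<eta> eq by (intro mono) (auto simp: M_def S_def)
        then have "p (S (a j) n - W J) \<le> \<eta> + \<delta> / 2 ^ n"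
          unfolding eq using le that by (simp add: S_diff W_eq)
        with p.triangle_sub[OF W_X S_X, of J "a j" n] p.minus_commute[OF W_X S_X, of J "a j" n]
        show ?thesis by simp
      qed
      moreover have "(\<lambda>j. p (S (a j) n) + (\<eta> + \<delta> / 2 ^ n)) \<longlonglongrightarrow> 0 + (\<eta> + \<delta> / 2 ^ n)" for n
        unfolding S_def using e a by (intro tendsto_intros p.sum_scale_tendsto_0) auto
      ultimately have "p (W J) \<le> 0 + (\<eta> + \<delta> / 2 ^ n)" if "m J \<le> n" for n
        using that by (meson LIMSEQ_le_const)
      moreover have "(\<lambda>n. 0 + (\<eta> + \<delta> / 2 ^ n)) \<longlonglongrightarrow> 0 + (\<eta> + 0)"
        by (intro tendsto_intros LIMSEQ_divide_realpow_zero) auto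
      ultimately have "p (W J) \<le> 0 + (\<eta> + 0)" by (meson LIMSEQ_le_const)
      then show ?thesis
        using p.triangle_sub[OF w W_X, of J] p.minus_commute[OF w W_X, of J] J[of J] \<eta> by simp
    qed
    note small = this
    have "p w \<le> 0"
    proof (rule field_le_epsilon)
      fix \<eta> :: real assume "0 < \<eta>"
      then show "p w \<le> 0 + \<eta>" using small[of "min \<delta> (\<eta> / 2)"] \<delta> by simp
    qed
    then show "w = 0" using p.eq_0[OF w] p_nonneg[OF w] by simp
  qed
  have coeff': "\<forall>i<n. norm (a i) \<le> 1" if "N (\<Sum>i<n. a i *s e i) \<le> \<delta>" for n :: nat and a
    using coeff[of a n] order_trans[OF p_le_N[OF S_X] that[folded S_def]] unfolding S_def by blast
  show thesis
  proof (rule that[of \<delta> e, OF \<delta> e])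
    show "\<forall>i<n. norm (a i) \<le> 1" if "N (\<Sum>i<n. a i *s e i) \<le> \<delta>" for n :: nat and a
      using that by (rule coeff')
  qed (use zero in \<open>auto simp: S_def\<close>)
qed

end

section \<open>Topological vector spaces and F-spaces\<close>

text \<open>The embedding \<open>h\<close> is an isometry with closed range, so it identifies the
  disc with a compact part of the complex unit disc.\<close>

lemma compact_cball_real_or_complex: "compact (cball (0::'k::real_or_complex) 1)"
proof -
  obtain h :: "'k \<Rightarrow> complex" where add: "\<And>x y. h (x + y) = h x + h y"
    and norm: "\<And>x. norm (h x) = norm x" and range: "range h = \<real> \<or> range h = UNIV"
    using real_or_complex_embedding[where 'a='k] by blast
  have diff: "h (x - y) = h x - h y" for x y using add[of "x - y" y] by simp
  have inj: "inj h"
  proof (rule injI)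
    fix x y assume "h x = h y"
    then show "x = y" using norm[of "x - y"] diff[of x y] by simp
  qed
  have "h ` cball 0 1 = range h \<inter> cball 0 1" using norm by auto
  moreover have "closed (range h)" using range closed_complex_Reals by auto
  ultimately have "compact (h ` cball 0 1)" by (simp add: closed_Int_compact)
  moreover have "continuous_on (h ` cball 0 1) (inv h)"
  proof (unfold continuous_on_iff, intro ballI allI impI)
    fix z and \<epsilon> :: real assume "z \<in> h ` cball 0 1" "0 < \<epsilon>"
    then show "\<exists>d>0. \<forall>w\<in>h ` cball 0 1. dist w z < d \<longrightarrow> dist (inv h w) (inv h z) < \<epsilon>"
      by (intro exI[of _ \<epsilon>]) (auto simp: inv_f_f[OF inj] dist_norm simp flip: diff norm)
  qed
  ultimately have "compact (inv h ` h ` cball 0 1)" by (rule compact_continuous_image[rotated])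
  then show ?thesis by (simp add: image_image inv_f_f[OF inj])
qed

section \<open>Neighbourhoods of 0 in a topological vector space\<close>

lemma openin_prod_nbhd:
  assumes "openin (prod_topology S T) W" "(x, y) \<in> W"
  obtains U V where "openin S U" "openin T V" "x \<in> U" "y \<in> V" "U \<times> V \<subseteq> W"
  using assms unfolding openin_prod_topology_alt by metis

context
  fixes smul :: "'k::real_normed_field \<Rightarrow> 'a::ab_group_add \<Rightarrow> 'a" and T :: "'a topology"
  assumes tvs: "tvs smul T"
begin

interpretation vector_space smul using tvs by (simp add: tvs_def)

lemma tvs_subspace: "subspace (topspace T)" using tvs by (simp add: tvs_def)

lemma tvs_continuous_add: "continuous_map (prod_topology T T) T (\<lambda>(x, y). x + y)"
  and tvs_continuous_scale: "continuous_map (prod_topology euclidean T) T (\<lambda>(a, x). smul a x)"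
  using tvs by (auto simp: tvs_def)

lemma tvs_continuous_translation:
  assumes "y \<in> topspace T" shows "continuous_map T T (\<lambda>x. x + y)"
proof -
  have "continuous_map T (prod_topology T T) (\<lambda>x. (x, y))"
    using assms by (intro continuous_map_pairedI) auto
  from continuous_map_compose[OF this tvs_continuous_add] show ?thesis by (simp add: o_def)
qed

lemma tvs_continuous_scale_right: "continuous_map T T (smul t)"
proof -
  have "continuous_map T (prod_topology euclidean T) (\<lambda>x. (t, x))"
    by (intro continuous_map_pairedI) auto
  from continuous_map_compose[OF this tvs_continuous_scale] show ?thesis by (simp add: o_def)
qed

lemma tvs_continuous_scale_left:
  assumes "x \<in> topspace T" shows "continuous_map euclidean T (\<lambda>t. smul t x)"
proof -
  have "continuous_map euclidean (prod_topology euclidean T) (\<lambda>t. (t, x))"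
    using assms by (intro continuous_map_pairedI) auto
  from continuous_map_compose[OF this tvs_continuous_scale] show ?thesis by (simp add: o_def)
qed

lemma tvs_add_nbhd:
  assumes "openin T U" "0 \<in> U"
  shows "\<exists>V. openin T V \<and> 0 \<in> V \<and> (\<forall>x\<in>V. \<forall>y\<in>V. x + y \<in> U)"
proof -
  have "openin (prod_topology T T) {z \<in> topspace (prod_topology T T). (\<lambda>(x, y). x + y) z \<in> U}"
    using openin_continuous_map_preimage[OF tvs_continuous_add assms(1)] .
  moreover have "(0, 0) \<in> {z \<in> topspace (prod_topology T T). (\<lambda>(x, y). x + y) z \<in> U}"
    using assms subspace_0[OF tvs_subspace] by simp
  ultimately obtain V V' where V: "openin T V" "openin T V'" "0 \<in> V" "0 \<in> V'"
    "V \<times> V' \<subseteq> {z \<in> topspace (prod_topology T T). (\<lambda>(x, y). x + y) z \<in> U}"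
    by (rule openin_prod_nbhd)
  then show ?thesis by (intro exI[of _ "V \<inter> V'"]) auto
qed

text \<open>Joint continuity at \<open>(0, 0)\<close> treats only scalars below some radius
  \<open>r\<close>. Replacing \<open>V\<close> by its preimage under division by a scalar
  \<open>c\<close> with \<open>0 < norm c < r\<close> extends this to the whole unit disc.\<close>

lemma tvs_balanced_nbhd:
  assumes "openin T U" "0 \<in> U"
  shows "\<exists>V. openin T V \<and> 0 \<in> V \<and> (\<forall>t x. norm t \<le> 1 \<longrightarrow> x \<in> V \<longrightarrow> smul t x \<in> U)"
proof -
  let ?P = "{z \<in> topspace (prod_topology euclidean T). (\<lambda>(a, x). smul a x) z \<in> U}"
  have "openin (prod_topology euclidean T) ?P"
    using openin_continuous_map_preimage[OF tvs_continuous_scale assms(1)] .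
  moreover have "(0, 0) \<in> ?P"
    using assms subspace_0[OF tvs_subspace] by simp
  ultimately obtain A V where V: "openin euclidean A" "openin T V" "0 \<in> A" "0 \<in> V" "A \<times> V \<subseteq> ?P"
    by (rule openin_prod_nbhd)
  have "open A" using V(1) by (rule open_openin[THEN iffD2])
  then obtain r where r: "r > 0" "ball 0 r \<subseteq> A" using V(3) openE by metis
  define c :: 'k where "c = of_real (r / 2)"
  have c: "c \<noteq> 0" "norm c < r" using r by (simp_all add: c_def)
  let ?V = "{x \<in> topspace T. smul (1 / c) x \<in> V}"
  have "smul t x \<in> U" if "norm t \<le> 1" "x \<in> ?V" for t x
  proof -
    have "norm (t * c) < r" using that c by (simp add: norm_mult) (metis le_less_trans mult_left_le_one_le norm_ge_zero)
    then have "smul (t * c) (smul (1 / c) x) \<in> U" using that V r by force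
    then show ?thesis using c by simp
  qed
  moreover have "openin T ?V"
    using openin_continuous_map_preimage[OF tvs_continuous_scale_right V(2)] .
  moreover have "0 \<in> ?V" using V subspace_0[OF tvs_subspace] by simp
  ultimately show ?thesis by blast
qed

text \<open>Allows vector topologies to be compared at 0 only.\<close>

lemma tvs_openin_translation:
  assumes "openin T U" "y \<in> topspace T" shows "openin T ((\<lambda>x. x + y) ` U)"
proof -
  have "(\<lambda>x. x + y) ` U = {x \<in> topspace T. x + - y \<in> U}"
    using assms openin_subset[OF assms(1)] tvs_subspace
    by (auto simp: image_iff subspace_add intro!: bexI[of _ "_ - y"])
  then show ?thesis
    using openin_continuous_map_preimage[OF tvs_continuous_translation assms(1), of "- y"]
      subspace_neg[OF tvs_subspace assms(2)] by simp
qed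

end

section \<open>From a translation-invariant metric to an F-norm\<close>

locale F_space_norm = complete_F_norm smul "topspace E" N
  for smul :: "'k::real_or_complex \<Rightarrow> 'a::ab_group_add \<Rightarrow> 'a" (infixr "*s" 75)
    and E :: "'a topology" and N +
  assumes tvs_E: "tvs smul E"
    and openin_iff: "openin E U \<longleftrightarrow>
      U \<subseteq> topspace E \<and> (\<forall>x\<in>U. \<exists>\<epsilon>>0. \<forall>y\<in>topspace E. N (y - x) < \<epsilon> \<longrightarrow> y \<in> U)"

text \<open>The metric of an F-space need not have balanced balls; passing to the supremum over the unit
  ball of scalars repairs this, and the truncation by \<open>1\<close> makes that supremum finite.\<close>

lemma F_space_imp_F_space_norm:
  fixes smul :: "'k::real_or_complex \<Rightarrow> 'a::ab_group_add \<Rightarrow> 'a"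
  assumes "F_space smul E"
  shows "\<exists>N. F_space_norm smul E N"
proof -
  have tvs: "tvs smul E" using assms by (simp add: F_space_def)
  interpret vector_space smul using tvs by (simp add: tvs_def)
  define X where "X = topspace E"
  have X: "subspace X" using tvs_subspace[OF tvs] by (simp add: X_def)
  obtain d where d: "Metric_space X d"
    and inv: "\<And>x y z. x \<in> X \<Longrightarrow> y \<in> X \<Longrightarrow> z \<in> X \<Longrightarrow> d (x + z) (y + z) = d x y"
    and comp: "Metric_space.mcomplete X d" and E: "E = Metric_space.mtopology X d"
    using assms unfolding F_space_def X_def by blast
  interpret d: Metric_space X d by fact
  define g where "g x = min 1 (d x 0)" for x
  define N where "N x = (SUP t\<in>cball 0 1. g (smul t x))" for x
  have X0: "0 \<in> X" using X by (rule subspace_0)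
  have X_sc: "smul t x \<in> X" if "x \<in> X" for t x using X that by (rule subspace_scale)
  have X_diff: "x - y \<in> X" if "x \<in> X" "y \<in> X" for x y using X that by (rule subspace_diff)
  have g_bounds: "0 \<le> g x" "g x \<le> 1" for x by (simp_all add: g_def)
  have bdd: "bdd_above ((\<lambda>t. g (smul t x)) ` cball 0 1)" for x
    by (rule bdd_aboveI[of _ 1]) (auto simp: g_bounds)
  have g_le_N: "g (smul t x) \<le> N x" if "norm t \<le> 1" for t x
    unfolding N_def by (rule cSUP_upper[OF _ bdd]) (use that in simp)
  have N_le: "N x \<le> s" if "\<And>t. norm t \<le> 1 \<Longrightarrow> g (smul t x) \<le> s" for x s
    unfolding N_def by (rule cSUP_least) (use that in auto)
  have d_diff: "d x y = d (x - y) 0" if "x \<in> X" "y \<in> X" for x y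
    using inv[of "x - y" 0 y] X0 X_diff that by simp
  have g_triangle: "g (x + y) \<le> g x + g y" if "x \<in> X" "y \<in> X" for x y
  proof -
    have "d (x + y) 0 \<le> d (x + y) (0 + y) + d y 0"
      using d.triangle[of "x + y" y 0] that X X0 by (simp add: subspace_add)
    also have "d (x + y) (0 + y) = d x 0" using inv that X0 by blast
    finally show ?thesis using d.nonneg[of x 0] d.nonneg[of y 0] unfolding g_def by linarith
  qed
  \<comment> \<open>At values from 1 on, the truncated \<open>g\<close> no longer determines
    \<open>d\<close>; hence the minimum with 1.\<close>
  have d_less: "d x 0 < \<epsilon>" if "N x < min \<epsilon> 1" for x \<epsilon>
    using g_le_N[of 1 x] that by (auto simp: g_def)
  \<comment> \<open>Continuity of scalar multiplication bounds the supremum: all multiples by the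
    unit disc of a small vector stay in one ball. Its radius is \<open>\<epsilon> / 2\<close>
    because a supremum of strict bounds is only a weak bound.\<close>
  have N_small: "\<exists>r>0. \<forall>x\<in>X. d x 0 < r \<longrightarrow> N x < \<epsilon>" if \<epsilon>: "0 < \<epsilon>" for \<epsilon>
  proof -
    have "openin E (d.mball 0 (\<epsilon> / 2))" "0 \<in> d.mball 0 (\<epsilon> / 2)" using \<epsilon> X0 by (auto simp: E)
    then obtain V where V: "openin E V" "0 \<in> V"
      "\<And>t x. norm t \<le> 1 \<Longrightarrow> x \<in> V \<Longrightarrow> smul t x \<in> d.mball 0 (\<epsilon> / 2)"
      using tvs_balanced_nbhd[OF tvs] by metis
    then obtain r where r: "r > 0" "d.mball 0 r \<subseteq> V" unfolding E d.openin_mtopology by blast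
    have "N x < \<epsilon>" if "x \<in> X" "d x 0 < r" for x
    proof -
      have "x \<in> V" using r that X0 by (auto simp: d.commute)
      have "N x \<le> \<epsilon> / 2"
      proof (rule N_le)
        fix t :: 'k assume "norm t \<le> 1"
        then have "d (smul t x) 0 < \<epsilon> / 2" using V(3)[OF _ \<open>x \<in> V\<close>, of t] by (simp add: d.commute)
        then show "g (smul t x) \<le> \<epsilon> / 2" by (simp add: g_def)
      qed
      then show ?thesis using \<epsilon> by simp
    qed
    with r show ?thesis by blast
  qed
  have N_nonneg: "0 \<le> N x" for x using g_le_N[of 0 x] g_bounds[of "smul 0 x"] by simp
  have "F_space_norm smul E N"
  proof
    show "subspace (topspace E)" using X by (simp add: X_def)
    show "x = 0" if "x \<in> topspace E" "N x = 0" for x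
      using g_le_N[of 1 x] that X0 by (auto simp: g_def X_def min_def split: if_splits) (use d.zero d.nonneg X_def order_antisym in metis)
    show "N (x + y) \<le> N x + N y" if "x \<in> topspace E" "y \<in> topspace E" for x y
    proof (rule N_le)
      fix t :: 'k assume t: "norm t \<le> 1"
      have "g (smul t (x + y)) \<le> g (smul t x) + g (smul t y)"
        unfolding scale_right_distrib using that by (intro g_triangle X_sc) (auto simp: X_def)
      then show "g (smul t (x + y)) \<le> N x + N y"
        using g_le_N[OF t, of x] g_le_N[OF t, of y] by linarith
    qed
    show "N (smul t x) \<le> N x" if "norm t \<le> 1" for t x
    proof (rule N_le)
      fix s :: 'k assume "norm s \<le> 1"
      then show "g (smul s (smul t x)) \<le> N x"
        using g_le_N[of "s * t" x] that by (simp add: norm_mult mult_le_one)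
    qed
    show "\<exists>r>0. \<forall>t. norm t < r \<longrightarrow> N (smul t x) < \<epsilon>" if x: "x \<in> topspace E" and \<epsilon>: "0 < \<epsilon>" for x \<epsilon>
    proof -
      obtain r where r: "r > 0" "\<And>x. x \<in> X \<Longrightarrow> d x 0 < r \<Longrightarrow> N x < \<epsilon>" using N_small[OF \<epsilon>] by blast
      have "open {t \<in> topspace euclidean. smul t x \<in> d.mball 0 r}"
        by (rule open_openin[THEN iffD2], rule openin_continuous_map_preimage[OF tvs_continuous_scale_left[OF tvs x]]) (simp add: E)
      moreover have "0 \<in> {t \<in> topspace euclidean. smul t x \<in> d.mball 0 r}" using r X0 by simp
      ultimately obtain s where s: "s > 0" "ball 0 s \<subseteq> {t \<in> topspace euclidean. smul t x \<in> d.mball 0 r}"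
        using open_contains_ball by blast
      have "N (smul t x) < \<epsilon>" if "norm t < s" for t
      proof -
        have "t \<in> ball 0 s" using that by simp
        then have "smul t x \<in> d.mball 0 r" using s by blast
        then show ?thesis using r(2) by (simp add: d.commute)
      qed
      then show ?thesis using s by blast
    qed
    show "\<exists>l\<in>topspace E. (\<lambda>n. N (s n - l)) \<longlonglongrightarrow> 0"
      if s: "range s \<subseteq> topspace E"
        and cauchy: "\<forall>\<epsilon>>0. \<exists>n. \<forall>j\<ge>n. \<forall>k\<ge>n. N (s j - s k) < \<epsilon>" for s
    proof -
      have sX: "s n \<in> X" for n using s by (auto simp: X_def)
      have "d.MCauchy s"
        unfolding d.MCauchy_def
      proof (intro conjI allI impI)
        show "range s \<subseteq> X" using sX by blast
        fix \<epsilon> :: real assume "\<epsilon> > 0"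
        then obtain n where "\<forall>j\<ge>n. \<forall>k\<ge>n. N (s j - s k) < min \<epsilon> 1"
          using cauchy by (meson min_less_iff_conj zero_less_one)
        then have "\<forall>j\<ge>n. \<forall>k\<ge>n. d (s j) (s k) < \<epsilon>" using d_diff[OF sX sX] d_less by metis
        then show "\<exists>N. \<forall>n n'. N \<le> n \<longrightarrow> N \<le> n' \<longrightarrow> d (s n) (s n') < \<epsilon>" by blast
      qed
      then obtain l where "limitin d.mtopology s l sequentially"
        using comp unfolding d.mcomplete_def by blast
      then have l: "l \<in> X" "\<And>r. r > 0 \<Longrightarrow> \<forall>\<^sub>F n in sequentially. s n \<in> X \<and> d (s n) l < r"
        unfolding d.limitin_metric by auto
      have "(\<lambda>n. N (s n - l)) \<longlonglongrightarrow> 0"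
      proof (rule tendstoI)
        fix \<epsilon> :: real assume "0 < \<epsilon>"
        then obtain r where r: "r > 0" "\<And>x. x \<in> X \<Longrightarrow> d x 0 < r \<Longrightarrow> N x < \<epsilon>" using N_small by blast
        show "\<forall>\<^sub>F n in sequentially. dist (N (s n - l)) 0 < \<epsilon>"
          using l(2)[OF r(1)]
          by eventually_elim (use r(2) l(1) d_diff X_diff N_nonneg in auto)
      qed
      then show ?thesis using l by (auto simp: X_def)
    qed
    show "openin E U \<longleftrightarrow>
      U \<subseteq> topspace E \<and> (\<forall>x\<in>U. \<exists>\<epsilon>>0. \<forall>y\<in>topspace E. N (y - x) < \<epsilon> \<longrightarrow> y \<in> U)" for U
    proof -
      have eq: "(\<exists>r>0. d.mball x r \<subseteq> U) \<longleftrightarrow> (\<exists>\<epsilon>>0. \<forall>y\<in>X. N (y - x) < \<epsilon> \<longrightarrow> y \<in> U)" if x: "x \<in> X" for x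
      proof
        assume "\<exists>r>0. d.mball x r \<subseteq> U"
        then obtain r where r: "r > 0" "d.mball x r \<subseteq> U" by blast
        have "y \<in> U" if "y \<in> X" "N (y - x) < min r 1" for y
          using r(2) x that d_less[OF that(2)] d_diff[of y x] by (auto simp: d.commute)
        with r show "\<exists>\<epsilon>>0. \<forall>y\<in>X. N (y - x) < \<epsilon> \<longrightarrow> y \<in> U"
          by (intro exI[of _ "min r 1"]) auto
      next
        assume "\<exists>\<epsilon>>0. \<forall>y\<in>X. N (y - x) < \<epsilon> \<longrightarrow> y \<in> U"
        then obtain \<epsilon> where \<epsilon>: "\<epsilon> > 0" "\<And>y. y \<in> X \<Longrightarrow> N (y - x) < \<epsilon> \<Longrightarrow> y \<in> U" by blast
        obtain r where r: "r > 0" "\<And>x. x \<in> X \<Longrightarrow> d x 0 < r \<Longrightarrow> N x < \<epsilon>" using N_small[OF \<epsilon>(1)] by blast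
        have "d.mball x r \<subseteq> U"
        proof
          fix y assume "y \<in> d.mball x r"
          then have "y \<in> X" "d (y - x) 0 < r" using d_diff[of y x] by (auto simp: d.commute)
          then show "y \<in> U" using \<epsilon>(2) r(2) X_diff x by blast
        qed
        then show "\<exists>r>0. d.mball x r \<subseteq> U" using r by blast
      qed
      have "openin E U \<longleftrightarrow> U \<subseteq> X \<and> (\<forall>x\<in>U. \<exists>r>0. d.mball x r \<subseteq> U)"
        by (simp add: E d.openin_mtopology Ball_def)
      also have "\<dots> \<longleftrightarrow> U \<subseteq> X \<and> (\<forall>x\<in>U. \<exists>\<epsilon>>0. \<forall>y\<in>X. N (y - x) < \<epsilon> \<longrightarrow> y \<in> U)"
        using eq by (intro conj_cong refl ball_cong) auto
      finally show ?thesis unfolding X_def .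
    qed
    show "tvs smul E" by (rule tvs)
  qed
  then show ?thesis by blast
qed

text \<open>Completeness of the scalars is derived from compactness: a tail of a Cauchy sequence
  lies in a translate of the unit disc.\<close>

lemma convergent_real_or_complex:
  fixes s :: "nat \<Rightarrow> 'k::real_or_complex"
  assumes "Cauchy s" obtains l where "s \<longlonglongrightarrow> l"
proof -
  obtain J where J: "\<And>n. n \<ge> J \<Longrightarrow> dist (s n) (s J) < 1"
    using assms unfolding Cauchy_altdef2 by (metis zero_less_one)
  have "\<forall>n. s (n + J) - s J \<in> cball 0 1"
    using J[OF le_add2] less_imp_le unfolding mem_cball_0 dist_norm by blast
  moreover have "Cauchy (\<lambda>n. s (n + J) - s J)"
    using assms unfolding Cauchy_def by (simp add: dist_norm) (meson trans_le_add1)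
  ultimately obtain l where "(\<lambda>n. s (n + J) - s J) \<longlonglongrightarrow> l"
    by (rule completeE[OF compact_imp_complete[OF compact_cball_real_or_complex]]) (rule that)
  then have "(\<lambda>n. s (n + J)) \<longlonglongrightarrow> l + s J"
    using tendsto_add[OF _ tendsto_const[of "s J"]] by fastforce
  then show thesis by (intro that) (rule LIMSEQ_offset)
qed

section \<open>Linearly independent sequences\<close>

context vector_space
begin

lemma span_image_lessThan:
  "v \<in> span (y ` {..<n::nat}) \<Longrightarrow> \<exists>a. v = (\<Sum>i<n. a i *s y i)"
proof (induction n arbitrary: v)
  case (Suc n)
  then obtain k where "v - k *s y n \<in> span (y ` {..<n})"
    by (auto simp: lessThan_Suc span_insert)
  then obtain a where a: "v - k *s y n = (\<Sum>i<n. a i *s y i)" using Suc.IH by blast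
  then have "v = (\<Sum>i<Suc n. (a(n := k)) i *s y i)" by (simp add: algebra_simps)
  then show ?case by blast
qed simp

text \<open>Each vector leaves the span of its predecessors, so the initial segments are independent
  sets of every size, exceeding \<open>card B\<close> in the end.\<close>

lemma not_finitely_spanned:
  assumes "\<And>n::nat. y n \<notin> span (y ` {..<n})" and B: "finite B"
  shows "\<not> range y \<subseteq> span B"
proof
  assume "range y \<subseteq> span B"
  moreover have "independent (y ` {..<n}) \<and> card (y ` {..<n}) = n" for n
  proof (induction n)
    case (Suc n)
    with assms(1)[of n] show ?case
      by (auto simp: lessThan_Suc independent_insert card_insert_if intro: span_base)
  qed (simp add: independent_empty)
  ultimately show False
    using independent_span_bound[OF B, of "y ` {..<Suc (card B)}"]
    by (metis image_mono order_trans subset_UNIV not_less_eq_eq order_refl)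
qed

end

context F_norm
begin

lemma tendsto_scale:
  assumes "\<And>j. y j \<in> X" "(\<lambda>j. N (y j)) \<longlonglongrightarrow> 0"
  shows "(\<lambda>j. N (t *s y j)) \<longlonglongrightarrow> 0"
proof -
  obtain n where n: "norm t \<le> of_nat n" using real_arch_simple by blast
  have le: "N (t *s y j) \<le> of_nat n * N (y j)" for j
    using balanced_mono[of "y j" t "of_nat n"] scale_numeral_le[of "y j" n] n assms(1)
    by (auto intro: order_trans)
  have lim: "(\<lambda>j. of_nat n * N (y j)) \<longlonglongrightarrow> 0"
    using tendsto_mult_right_zero[OF assms(2)] by blast
  have "0 \<le> N (t *s y j)" for j using assms by (simp add: nonneg X_scale)
  with le show ?thesis
    using tendsto_sandwich[OF _ _ tendsto_const lim] by simp
qed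

lemma ex_small_scale:
  assumes "x \<in> X" "0 < \<epsilon>"
  obtains t where "t \<noteq> 0" "norm t \<le> 1" "N (t *s x) \<le> \<epsilon>"
proof -
  obtain r where r: "r > 0" "\<And>t. norm t < r \<Longrightarrow> N (t *s x) < \<epsilon>" using absorbing assms by metis
  let ?t = "of_real (min 1 (r / 2))"
  have "norm (?t :: 'k) < r" "norm (?t :: 'k) \<le> 1" using r by auto
  with r show thesis by (intro that[of ?t]) (auto intro: less_imp_le)
qed

end

section \<open>The topology of an F-space described by its F-norm\<close>

context F_space_norm
begin

abbreviation "X \<equiv> topspace E"

lemma openin_ball: "x \<in> X \<Longrightarrow> openin E {y \<in> X. N (y - x) < \<epsilon>}"
  unfolding openin_iff
proof (intro conjI ballI)
  fix y assume x: "x \<in> X" and "y \<in> {y \<in> X. N (y - x) < \<epsilon>}"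
  then have y: "y \<in> X" "N (y - x) < \<epsilon>" by auto
  have "N (z - x) < \<epsilon>" if "z \<in> X" "N (z - y) < \<epsilon> - N (y - x)" for z
    using triangle[OF X_diff X_diff, of z y y x] x y that by simp
  then show "\<exists>\<epsilon>'>0. \<forall>z\<in>X. N (z - y) < \<epsilon>' \<longrightarrow> z \<in> {y \<in> X. N (y - x) < \<epsilon>}"
    using y by (intro exI[of _ "\<epsilon> - N (y - x)"]) auto
qed auto

lemma limitin_iff:
  assumes s: "\<And>n. s n \<in> X" and l: "l \<in> X"
  shows "limitin E s l sequentially \<longleftrightarrow> (\<lambda>n. N (s n - l)) \<longlonglongrightarrow> 0"
proof
  assume lim: "limitin E s l sequentially"
  show "(\<lambda>n. N (s n - l)) \<longlonglongrightarrow> 0"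
  proof (rule tendstoI)
    fix \<epsilon> :: real assume "0 < \<epsilon>"
    then have "l \<in> {y \<in> X. N (y - l) < \<epsilon>}" using l by (simp add: N_0)
    then have "\<forall>\<^sub>F n in sequentially. s n \<in> {y \<in> X. N (y - l) < \<epsilon>}"
      using lim openin_ball[OF l] unfolding limitin_def by blast
    then show "\<forall>\<^sub>F n in sequentially. dist (N (s n - l)) 0 < \<epsilon>"
      by eventually_elim (use s l in \<open>auto simp: nonneg X_diff\<close>)
  qed
next
  assume lim: "(\<lambda>n. N (s n - l)) \<longlonglongrightarrow> 0"
  show "limitin E s l sequentially"
    unfolding limitin_def
  proof (intro conjI allI impI l)
    fix U assume "openin E U \<and> l \<in> U"
    then obtain \<epsilon> where \<epsilon>: "\<epsilon> > 0" "\<forall>y\<in>X. N (y - l) < \<epsilon> \<longrightarrow> y \<in> U" unfolding openin_iff by blast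
    have "\<forall>\<^sub>F n in sequentially. N (s n - l) < \<epsilon>" using order_tendstoD(2)[OF lim \<epsilon>(1)] .
    then show "\<forall>\<^sub>F n in sequentially. s n \<in> U" by eventually_elim (use \<epsilon> s in blast)
  qed
qed

lemma closedin_limit:
  assumes "closedin E C" "\<And>n. s n \<in> C" "l \<in> X" "(\<lambda>n. N (s n - l)) \<longlonglongrightarrow> 0"
  shows "l \<in> C"
proof -
  have "\<And>n. s n \<in> X" using assms(1,2) closedin_subset by blast
  then have "limitin E s l sequentially" using limitin_iff assms by blast
  then show ?thesis
    by (rule limitin_closedin[OF _ assms(1)]) (use assms(2) in auto)
qed

lemma Hausdorff_E: "Hausdorff_space E"
  unfolding Hausdorff_space_def
proof (intro allI impI, elim conjE)
  fix x y assume xy: "x \<in> X" "y \<in> X" "x \<noteq> y"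
  let ?r = "N (x - y) / 2"
  have "N (x - y) \<noteq> 0" using eq_0[of "x - y"] X_diff xy by auto
  then have r: "?r > 0" using nonneg[of "x - y"] X_diff xy by simp
  have "disjnt {z \<in> X. N (z - x) < ?r} {z \<in> X. N (z - y) < ?r}"
    unfolding disjnt_iff
  proof (intro allI notI, elim conjE)
    fix z assume "z \<in> {z \<in> X. N (z - x) < ?r}" "z \<in> {z \<in> X. N (z - y) < ?r}"
    then have z: "z \<in> X" "N (z - x) < ?r" "N (z - y) < ?r" by auto
    have "N (x - y) \<le> N (z - y) + N (z - x)"
      using triangle_diff[of "z - y" "z - x"] X_diff z xy by simp
    with z show False by simp
  qed
  moreover have "openin E {z \<in> X. N (z - x) < ?r}" "openin E {z \<in> X. N (z - y) < ?r}"
    using xy openin_ball by blast+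
  moreover have "x \<in> {z \<in> X. N (z - x) < ?r}" "y \<in> {z \<in> X. N (z - y) < ?r}"
    using r xy by (simp_all add: N_0)
  ultimately show "\<exists>U V. openin E U \<and> openin E V \<and> x \<in> U \<and> y \<in> V \<and> disjnt U V"
    by blast
qed

text \<open>Writing the closure of \<open>D\<close> through \<open>N\<close> makes approximating
  elements of \<open>D\<close> directly available.\<close>

lemma closed_subspace_closure:
  assumes D: "subspace D" "D \<subseteq> X"
  shows "closed_subspace smul E {z \<in> X. \<forall>\<epsilon>>0. \<exists>d\<in>D. N (z - d) < \<epsilon>}" (is "closed_subspace _ _ ?Z")
  unfolding closed_subspace_def
proof
  show "subspace ?Z"
  proof (rule subspaceI)
    show "0 \<in> ?Z" using X_0 subspace_0[OF D(1)] by (auto simp: N_0 intro!: bexI[of _ 0])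
    fix z assume z: "z \<in> ?Z"
    { fix w assume w: "w \<in> ?Z"
      have "\<exists>d\<in>D. N (z + w - d) < \<epsilon>" if \<epsilon>: "\<epsilon> > 0" for \<epsilon>
      proof -
        from z w \<epsilon> obtain d d' where d: "d \<in> D" "d' \<in> D" "N (z - d) < \<epsilon> / 2" "N (w - d') < \<epsilon> / 2"
          using half_gt_zero by blast
        have "N ((z - d) + (w - d')) \<le> N (z - d) + N (w - d')"
          using z w d D by (intro triangle X_diff) auto
        then have "N (z + w - (d + d')) < \<epsilon>" using d by (simp add: algebra_simps)
        with d show ?thesis using subspace_add[OF D(1)] by blast
      qed
      then show "z + w \<in> ?Z" using z w X_add by auto }
    fix t :: 'k
    obtain n where n: "norm t \<le> of_nat n" "n > 0"
      using real_arch_simple[of "max 1 (norm t)"] by (metis max.boundedE of_nat_0 not_one_le_zero gr0I)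
    have "\<exists>d\<in>D. N (t *s z - d) < \<epsilon>" if \<epsilon>: "\<epsilon> > 0" for \<epsilon>
    proof -
      have "\<epsilon> / of_nat n > 0" using \<epsilon> n by simp
      then obtain d where d: "d \<in> D" "N (z - d) < \<epsilon> / of_nat n" using z by blast
      have zd: "z - d \<in> X" using z d D by (intro X_diff) auto
      have "N (t *s (z - d)) \<le> of_nat n * N (z - d)"
        using balanced_mono[OF zd, of t "of_nat n"] scale_numeral_le[OF zd, of n] n by simp
      also have "\<dots> < \<epsilon>" using d n by (simp add: field_simps)
      finally show ?thesis
        using subspace_scale[OF D(1) d(1), of t] by (auto simp: scale_right_diff_distrib)
    qed
    then show "t *s z \<in> ?Z" using z X_scale by auto
  qed
  show "closedin E ?Z"
    unfolding closedin_def openin_iff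
  proof (intro conjI ballI)
    fix x assume x: "x \<in> X - ?Z"
    then obtain \<epsilon> where \<epsilon>: "\<epsilon> > 0" "\<And>d. d \<in> D \<Longrightarrow> \<epsilon> \<le> N (x - d)" by force
    have "y \<notin> ?Z" if y: "y \<in> X" "N (y - x) < \<epsilon> / 2" for y
    proof
      assume "y \<in> ?Z"
      then obtain d where d: "d \<in> D" "N (y - d) < \<epsilon> / 2" using \<epsilon>(1) half_gt_zero by blast
      have "N (x - d) \<le> N (x - y) + N (y - d)"
        using triangle[of "x - y" "y - d"] X_diff x y d D by (simp add: subset_iff)
      with \<epsilon>(2)[OF d(1)] d y minus_commute[of x y] x show False by simp
    qed
    then show "\<exists>\<epsilon>>0. \<forall>y\<in>X. N (y - x) < \<epsilon> \<longrightarrow> y \<in> X - ?Z"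
      using \<epsilon> by (intro exI[of _ "\<epsilon> / 2"]) auto
  qed auto
qed

lemma compactin_add_scale:
  assumes A: "compactin E A" and C: "compact C" and y: "y \<in> X"
  shows "compactin E ((\<lambda>(x, t). x + t *s y) ` (A \<times> C))"
proof (rule image_compactin)
  show "compactin (prod_topology E euclidean) (A \<times> C)"
    using A C by (simp add: compactin_Times)
  have "continuous_map (prod_topology E euclidean) (prod_topology E E) (\<lambda>z. (fst z, snd z *s y))"
    using continuous_map_compose[OF continuous_map_snd tvs_continuous_scale_left[OF tvs_E y]]
    by (intro continuous_map_pairedI continuous_map_fst) (simp add: o_def)
  from continuous_map_compose[OF this tvs_continuous_add[OF tvs_E]]
  show "continuous_map (prod_topology E euclidean) E (\<lambda>(x, t). x + t *s y)"
    by (simp add: o_def case_prod_unfold)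
qed

text \<open>Total boundedness would not be enough here: \<open>box_lower_bound\<close> needs a
  closed set, which compactness in the Hausdorff space \<open>E\<close> provides.\<close>

lemma compactin_box:
  "(\<And>i. e i \<in> X) \<Longrightarrow> compactin E ((\<lambda>a. \<Sum>i<n::nat. a i *s e i) ` {a. \<forall>i<n. norm (a i) \<le> 1})"
proof (induction n)
  case 0
  have "(\<lambda>a. \<Sum>i<0. a i *s e i) ` {a. \<forall>i<0. norm (a i) \<le> 1} = {0}" by auto
  then show ?case by (simp add: X_0)
next
  case (Suc n)
  let ?B = "\<lambda>n. (\<lambda>a. \<Sum>i<n. a i *s e i) ` {a. \<forall>i<n. norm (a i) \<le> 1}"
  have "(\<lambda>(x, t). x + t *s e n) ` (?B n \<times> cball 0 1) = ?B (Suc n)"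
  proof (intro equalityI subsetI)
    fix z assume "z \<in> (\<lambda>(x, t). x + t *s e n) ` (?B n \<times> cball 0 1)"
    then obtain a t where "\<forall>i<n. norm (a i) \<le> 1" "norm t \<le> 1" "z = (\<Sum>i<n. a i *s e i) + t *s e n"
      by auto
    then show "z \<in> ?B (Suc n)"
      by (intro image_eqI[of _ _ "a(n := t)"]) (auto simp: less_Suc_eq)
  next
    fix z assume "z \<in> ?B (Suc n)"
    then obtain a where "\<forall>i<Suc n. norm (a i) \<le> 1" "z = (\<Sum>i<n. a i *s e i) + a n *s e n" by auto
    then show "z \<in> (\<lambda>(x, t). x + t *s e n) ` (?B n \<times> cball 0 1)"
      by (intro image_eqI[of _ _ "((\<Sum>i<n. a i *s e i), a n)"]) auto
  qed
  with compactin_add_scale[OF Suc.IH compact_cball_real_or_complex, of "e n"] Suc.prems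
  show ?case by simp
qed

lemma closedin_lower_bound:
  assumes A: "closedin E A" "0 \<notin> A"
  obtains \<delta> where "\<delta> > 0" "\<And>z. z \<in> A \<Longrightarrow> \<delta> \<le> N z"
proof -
  have "openin E (X - A)" "0 \<in> X - A" using A X_0 by auto
  then obtain \<delta> where \<delta>: "\<delta> > 0" "\<forall>z\<in>X. N (z - 0) < \<delta> \<longrightarrow> z \<in> X - A"
    unfolding openin_iff by blast
  have "\<delta> \<le> N z" if "z \<in> A" for z
    using \<delta>(2) that closedin_subset[OF A(1)] by (metis DiffD2 diff_zero not_le_imp_less subsetD)
  with \<delta>(1) show thesis by (rule that)
qed

text \<open>These combinations form a compact, hence closed, set that misses 0 because
  \<open>y\<close> is outside the span; so it misses a ball about 0. The modulus of \<open>c\<close>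
  starts at \<open>1 / 2\<close> because the supremum norm, by which coefficients will be
  normalised, need not be attained.\<close>

lemma box_lower_bound:
  assumes e: "\<And>i. e i \<in> X" and y: "y \<in> X" "y \<notin> span (e ` {..<n::nat})"
  shows "\<exists>\<delta>>0. \<forall>a c. (\<forall>i<n. norm (a i) \<le> 1) \<longrightarrow> 1 / 2 \<le> norm c \<longrightarrow> norm c \<le> 1 \<longrightarrow>
    \<delta> \<le> N ((\<Sum>i<n. a i *s e i) + c *s y)"
proof -
  let ?B = "(\<lambda>a. \<Sum>i<n. a i *s e i) ` {a. \<forall>i<n. norm (a i) \<le> 1}"
  let ?C = "cball (0::'k) 1 - ball 0 (1 / 2)"
  let ?A = "(\<lambda>(x, t). x + t *s y) ` (?B \<times> ?C)"
  have "compact ?C" by (intro compact_diff compact_cball_real_or_complex open_ball)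
  then have "compactin E ?A"
    by (intro compactin_add_scale compactin_box e y)
  then have "closedin E ?A"
    using compactin_imp_closedin[OF Hausdorff_E] by blast
  moreover have "0 \<notin> ?A"
  proof
    assume "0 \<in> ?A"
    then obtain a c where c: "c \<notin> ball 0 (1 / 2)" and eq: "(\<Sum>i<n. a i *s e i) + c *s y = 0" by auto
    from c have "c \<noteq> 0" by auto
    have "c *s y = - (\<Sum>i<n. a i *s e i)" using eq by (simp add: eq_neg_iff_add_eq_0 add.commute)
    also have "\<dots> \<in> span (e ` {..<n})"
      by (intro span_neg span_sum span_scale span_base) auto
    finally have "inverse c *s (c *s y) \<in> span (e ` {..<n})" by (rule span_scale)
    with \<open>c \<noteq> 0\<close> y show False by simp
  qed
  ultimately obtain \<delta> where \<delta>: "\<delta> > 0" "\<And>z. z \<in> ?A \<Longrightarrow> \<delta> \<le> N z"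
    by (rule closedin_lower_bound) (rule that)
  show ?thesis
  proof (intro exI[of _ \<delta>] conjI allI impI \<delta>(1))
    fix a :: "nat \<Rightarrow> 'k" and c :: 'k
    assume "\<forall>i<n. norm (a i) \<le> 1" "1 / 2 \<le> norm c" "norm c \<le> 1"
    then have "(\<Sum>i<n. a i *s e i) + c *s y \<in> ?A"
      by (intro image_eqI[of _ _ "(\<Sum>i<n. a i *s e i, c)"]) auto
    then show "\<delta> \<le> N ((\<Sum>i<n. a i *s e i) + c *s y)"
      by (intro \<delta>(2))
  qed
qed

end

section \<open>Spaceability\<close>

lemma sup_norm_witness:
  assumes c: "c \<in> linf" and n: "c n \<noteq> 0"
  obtains k where "0 < sup_norm c" "sup_norm c / 2 \<le> norm (c k)"
proof -
  have pos: "0 < sup_norm c"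
    using sup_norm_upper[OF c, of n] n by (meson less_le_trans zero_less_norm_iff)
  have "\<exists>k. sup_norm c / 2 \<le> norm (c k)"
  proof (rule ccontr)
    assume "\<not> ?thesis"
    then have "\<And>k. norm (c k) \<le> sup_norm c / 2" by (simp add: not_le less_imp_le)
    then have "(SUP n. norm (c n)) \<le> sup_norm c / 2" by (intro cSUP_least) auto
    then show False using pos c by (simp add: sup_norm_def)
  qed
  with pos that show thesis by blast
qed

lemma c0_subset_linf: "c0 \<subseteq> linf"
  using convergent_imp_bounded by (auto simp: c0_def linf_def)

lemma closed_subspace_linf: "closed_subspace seq_scale linf_topology (linf :: (nat \<Rightarrow> 'k::real_normed_field) set)"
proof -
  interpret vector_space "seq_scale :: 'k \<Rightarrow> _" by (rule vector_space_seq_scale)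
  interpret Metric_space "linf :: (nat \<Rightarrow> 'k) set" "\<lambda>c d. sup_norm (c - d)" by (rule Metric_space_linf)
  have "subspace (linf :: (nat \<Rightarrow> 'k) set)"
  proof (rule subspaceI)
    show "(0 :: nat \<Rightarrow> 'k) \<in> linf" by (simp add: linf_def zero_fun_def)
    show "c + d \<in> linf" if "c \<in> linf" "d \<in> linf" for c d :: "nat \<Rightarrow> 'k"
      using bounded_plus_comp[of c UNIV d] that by (simp add: linf_def plus_fun_def)
    show "seq_scale t c \<in> linf" if c: "c \<in> linf" for t and c :: "nat \<Rightarrow> 'k"
    proof -
      obtain B where "\<And>n. norm (c n) \<le> B" using c by (auto simp: linf_def bounded_iff)
      then have "norm (t * c n) \<le> norm t * B" for n by (simp add: norm_mult mult_left_mono)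
      then show ?thesis unfolding linf_def seq_scale_def bounded_iff by blast
    qed
  qed
  then show ?thesis
    unfolding closed_subspace_def linf_topology_def
    using closedin_topspace[of mtopology] by simp
qed

section \<open>Constructions for the two implications\<close>

context F_space_norm
begin

text \<open>The coefficient sequences are bounded, so some coefficient has at least half the modulus of
  all others. The lower bound \<open>\<delta> n\<close> for the combinations of \<open>x 0, \<dots>, x n\<close> whose last coefficient
  is of this kind dominates all later terms of the series.\<close>

lemma ex_linf_independent_sequence:
  assumes S: "closed_subspace smul E S" and inf: "infinite_dimensional smul S"
  obtains x where "range x \<subseteq> S" "S_independent smul E linf x"
    "\<And>c. c \<in> linf \<Longrightarrow> \<exists>l\<in>S. series_converges_to smul E x c l"
proof -
  have S_sub: "subspace S" and S_cl: "closedin E S" and SX: "S \<subseteq> X"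
    using S closedin_subset by (auto simp: closed_subspace_def)
  \<comment> \<open>The second component is the lower bound belonging to the vector. The bound
    \<open>1 / 2 ^ n\<close> makes the series converge; the bounds
    \<open>snd (f k) / 2 ^ (n + 2)\<close> make all terms after \<open>k\<close> together at most
    half of the lower bound at \<open>k\<close>.\<close>
  define P where "P f n z \<longleftrightarrow> fst z \<in> S \<and> 0 < snd z \<and> N (fst z) \<le> 1 / 2 ^ n \<and>
      (\<forall>k<n. N (fst z) \<le> snd (f k) / 2 ^ (n + 2)) \<and>
      (\<forall>a c. (\<forall>i<n. norm (a i) \<le> 1) \<longrightarrow> 1 / 2 \<le> norm c \<longrightarrow> norm c \<le> 1 \<longrightarrow>
        snd z \<le> N ((\<Sum>i<n. a i *s fst (f i)) + c *s fst z))"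
    for f :: "nat \<Rightarrow> 'a \<times> real" and n z
  have "\<exists>f. \<forall>n. P f n (f n)"
  proof (rule dependent_wellorder_choice)
    show "P f n z \<longleftrightarrow> P g n z" if "\<And>i. i < n \<Longrightarrow> f i = g i" for z f g n
    proof -
      have "(\<Sum>i<n. a i *s fst (f i)) = (\<Sum>i<n. a i *s fst (g i))" for a using that by simp
      with that show ?thesis by (simp add: P_def)
    qed
    show "\<exists>z. P f n z" if prev: "\<And>i. i < n \<Longrightarrow> P f i (f i)" for n f
    proof -
      \<comment> \<open>Only the first \<open>n\<close> choices are known to lie in
        \<open>S\<close>; padding with 0 gives \<open>box_lower_bound\<close> a sequence that lies
        in \<open>X\<close> throughout.\<close>
      define e where "e i = (if i < n then fst (f i) else 0)" for i
      have e: "e i \<in> S" for i using prev subspace_0[OF S_sub] by (auto simp: e_def P_def)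
      have "\<not> S \<subseteq> span (e ` {..<n})"
        using inf e unfolding infinite_dimensional_def by blast
      then obtain v where v: "v \<in> S" "v \<notin> span (e ` {..<n})" by blast
      define \<epsilon> where "\<epsilon> = Min (insert (1 / 2 ^ n) ((\<lambda>k. snd (f k) / 2 ^ (n + 2)) ` {..<n}))"
      have "\<epsilon> > 0" using prev by (auto simp: \<epsilon>_def P_def)
      then obtain t where t: "t \<noteq> 0" "N (t *s v) \<le> \<epsilon>"
        using ex_small_scale v SX by (metis subsetD)
      have tv: "t *s v \<in> S" "t *s v \<notin> span (e ` {..<n})"
        using v t S_sub span_scale[of "t *s v" _ "inverse t"] by (auto simp: subspace_scale)
      then obtain \<delta> where \<delta>: "\<delta> > 0" "\<forall>a c. (\<forall>i<n. norm (a i) \<le> 1) \<longrightarrow> 1 / 2 \<le> norm c \<longrightarrow>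
          norm c \<le> 1 \<longrightarrow> \<delta> \<le> N ((\<Sum>i<n. a i *s e i) + c *s (t *s v))"
        using box_lower_bound[of e "t *s v" n] e SX by blast
      have "(\<Sum>i<n. a i *s e i) = (\<Sum>i<n. a i *s fst (f i))" for a by (simp add: e_def)
      with \<delta> tv have "P f n (t *s v, \<delta>)"
        unfolding P_def using order_trans[OF t(2)] by (auto simp: \<epsilon>_def)
      then show ?thesis by blast
    qed
  qed
  then obtain f where f: "\<And>n. P f n (f n)" by blast
  define x where "x n = fst (f n)" for n
  define \<delta> where "\<delta> n = snd (f n)" for n
  have x: "x n \<in> S" and \<delta>: "0 < \<delta> n" and x_small: "N (x n) \<le> 1 / 2 ^ n" for n
    using f[of n] by (auto simp: P_def x_def \<delta>_def)
  have x_\<delta>: "N (x n) \<le> \<delta> k / 2 ^ (n + 2)" if "k < n" for k n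
    using f[of n] that by (auto simp: P_def x_def \<delta>_def)
  have lower: "\<delta> n \<le> N (\<Sum>i<Suc n. a i *s x i)"
    if "\<forall>i<n. norm (a i) \<le> 1" "1 / 2 \<le> norm (a n)" "norm (a n) \<le> 1" for a n
    using f[of n] that by (auto simp: P_def x_def \<delta>_def)
  have xX: "x n \<in> X" for n using x SX by blast
  show thesis
  proof (rule that[of x])
    show "range x \<subseteq> S" using x by blast
    show "\<exists>l\<in>S. series_converges_to smul E x c l" if c: "c \<in> linf" for c
    proof -
      obtain B where B: "norm (c n) \<le> real B" for n
        using sup_norm_upper[OF c] real_arch_simple[of "sup_norm c"] order_trans by blast
      have le: "N (c n *s x n) \<le> real B * (1 / 2 ^ n)" for n
      proof -
        have "N (c n *s x n) \<le> N (of_nat B *s x n)" by (intro balanced_mono xX) (simp add: B)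
        also have "\<dots> \<le> real B * N (x n)" by (intro scale_numeral_le xX)
        also have "\<dots> \<le> real B * (1 / 2 ^ n)" by (intro mult_left_mono x_small) simp
        finally show ?thesis .
      qed
      have sm: "summable (\<lambda>n. real B * (1 / 2 ^ n))"
        using summable_mult[OF summable_geometric[of "1/2::real"]] by (simp add: power_one_over)
      obtain l where l: "l \<in> X" "(\<lambda>n. N ((\<Sum>i<n. c i *s x i) - l)) \<longlonglongrightarrow> 0"
        by (rule summable_imp_convergent[OF X_scale[OF xX] le sm]) (rule that)
      have S_sum: "(\<Sum>i<n. c i *s x i) \<in> S" for n
        using x S_sub by (intro subspace_sum subspace_scale)
      then have "l \<in> S" using closedin_limit[OF S_cl _ l] by blast
      moreover have "series_converges_to smul E x c l"
        unfolding series_converges_to_def using S_sum SX l by (subst limitin_iff) auto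
      ultimately show ?thesis by blast
    qed
    show "S_independent smul E linf x"
      unfolding S_independent_def
    proof (intro ballI impI allI)
      fix c n assume c: "c \<in> linf" and conv: "series_converges_to smul E x c 0"
      show "c n = 0"
      proof (rule ccontr)
        assume "c n \<noteq> 0"
        then obtain k where s: "0 < sup_norm c" and k: "sup_norm c / 2 \<le> norm (c k)"
          using sup_norm_witness c by blast
        \<comment> \<open>Dividing by the supremum norm puts all coefficients in the unit disc and
          the one at \<open>k\<close> in the range demanded by \<open>lower\<close>.\<close>
        define t :: 'k where "t = of_real (1 / sup_norm c)"
        define T where "T M = (\<Sum>i<M. (t * c i) *s x i)" for M
        have T_X: "T M \<in> X" for M unfolding T_def using xX by (intro X_sum X_scale)
        have norm_t: "norm t = 1 / sup_norm c" unfolding t_def norm_of_real using s by simp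
        have b1: "norm (t * c i) \<le> 1" for i
          using sup_norm_upper[OF c, of i] s by (simp add: norm_mult norm_t)
        have b2: "1 / 2 \<le> norm (t * c k)" using k s by (simp add: norm_mult norm_t field_simps)
        have psum: "(\<Sum>i<M. c i *s x i) \<in> X" for M using xX by (intro X_sum X_scale)
        have "(\<lambda>M. N (\<Sum>i<M. c i *s x i)) \<longlonglongrightarrow> 0"
          using conv psum X_0 by (simp add: series_converges_to_def limitin_iff)
        then have "(\<lambda>M. N (t *s (\<Sum>i<M. c i *s x i))) \<longlonglongrightarrow> 0"
          by (rule tendsto_scale[OF psum])
        then have lim: "(\<lambda>M. N (T M)) \<longlonglongrightarrow> 0" by (simp add: T_def scale_sum_right)
        \<comment> \<open>The sum through index \<open>k\<close> has size at least
          \<open>\<delta> k\<close>, and the later terms can cancel at most half of it.\<close>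
        have "\<delta> k / 2 \<le> N (T M)" if M: "Suc k \<le> M" for M
        proof -
          have "T M - T (Suc k) = (\<Sum>i=Suc k..<M. (t * c i) *s x i)"
            unfolding T_def lessThan_atLeast0 using M by (intro sum_diff_nat_ivl) auto
          then have "N (T M - T (Suc k)) \<le> (\<Sum>i=Suc k..<M. N ((t * c i) *s x i))"
            using triangle_sum[of "{Suc k..<M}" "\<lambda>i. (t * c i) *s x i"] xX X_scale by simp
          also have "\<dots> \<le> (\<Sum>i=Suc k..<M. \<delta> k / 2 ^ (i + 2))"
            using balanced[OF xX b1] x_\<delta> by (intro sum_mono) (meson atLeastLessThan_iff Suc_le_lessD order_trans)
          also have "\<dots> \<le> (\<Sum>i<M. \<delta> k / 2 ^ (i + 2))"
            using \<delta>[of k] by (intro sum_mono2) auto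
          also have "\<dots> = \<delta> k / 4 * (\<Sum>i<M. (1 / 2) ^ i)"
            by (simp add: sum_distrib_left power_one_over field_simps)
          also have "\<dots> \<le> \<delta> k / 4 * 2"
            using \<delta>[of k] by (intro mult_left_mono) (simp_all add: sum_gp_strict)
          finally have "N (T M - T (Suc k)) \<le> \<delta> k / 2" by simp
          moreover have "\<delta> k \<le> N (T (Suc k))"
            unfolding T_def using lower[of k "\<lambda>i. t * c i"] b1 b2 by blast
          moreover have "N (T (Suc k)) \<le> N (T M) + N (T M - T (Suc k))"
            using triangle_sub[OF T_X T_X] minus_commute[OF T_X T_X] by metis
          ultimately show ?thesis by linarith
        qed
        then have "\<delta> k / 2 \<le> 0" using LIMSEQ_le_const[OF lim] by blast
        with \<delta>[of k] show False by simp
      qed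
    qed
  qed
qed

text \<open>Closedness makes \<open>M\<close> complete for \<open>N\<close>. If every
  \<open>N\<close>-ball contained an \<open>R\<close>-neighbourhood of 0, translation would make
  \<open>R\<close> as fine as the induced topology; so some radius admits none, as
  \<open>nbhd_strict\<close> asks.\<close>

lemma nonminimal_imp_weaker_vector_topology:
  assumes M: "closed_subspace smul E M" and nonmin: "nonminimal_tvs smul (subtopology E M)"
  shows "\<exists>\<U>. weaker_vector_topology smul M N \<U>"
proof -
  have M_sub: "subspace M" and M_cl: "closedin E M" and MX: "M \<subseteq> X"
    using M closedin_subset by (auto simp: closed_subspace_def)
  have top: "topspace (subtopology E M) = M" using MX by auto
  obtain R where R: "topspace R = M" "tvs smul R" "Hausdorff_space R"
    and weaker: "\<And>U. openin R U \<Longrightarrow> openin (subtopology E M) U" and ne: "R \<noteq> subtopology E M"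
    using nonmin unfolding nonminimal_tvs_def minimal_tvs_def top by blast
  have M0: "0 \<in> M" using subspace_0[OF M_sub] .
  have "weaker_vector_topology smul M N {U. openin R U \<and> 0 \<in> U}"
  proof
    show "subspace M" by fact
    show "x = 0" if "x \<in> M" "N x = 0" for x using that eq_0 MX by blast
    show "N (x + y) \<le> N x + N y" if "x \<in> M" "y \<in> M" for x y using that triangle MX by blast
    show "N (t *s x) \<le> N x" if "x \<in> M" "norm t \<le> 1" for x t using that balanced MX by blast
    show "\<exists>r>0. \<forall>t. norm t < r \<longrightarrow> N (t *s x) < \<epsilon>" if "x \<in> M" "0 < \<epsilon>" for x \<epsilon>
      using that absorbing MX by blast
    show "\<exists>l\<in>M. (\<lambda>n. N (s n - l)) \<longlonglongrightarrow> 0"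
      if s: "range s \<subseteq> M" and cauchy: "\<forall>\<epsilon>>0. \<exists>n. \<forall>j\<ge>n. \<forall>k\<ge>n. N (s j - s k) < \<epsilon>" for s
    proof -
      obtain l where "l \<in> X" "(\<lambda>n. N (s n - l)) \<longlonglongrightarrow> 0" using complete[OF _ cauchy] s MX by blast
      then show ?thesis using closedin_limit[OF M_cl, of s l] s by blast
    qed
    show "M \<in> {U. openin R U \<and> 0 \<in> U}" using M0 R(1) openin_topspace[of R] by simp
    fix U assume "U \<in> {U. openin R U \<and> 0 \<in> U}"
    then have U: "openin R U" "0 \<in> U" by auto
    show "U \<subseteq> M" using openin_subset[OF U(1)] R by simp
    show "0 \<in> U" by fact
    show "U \<inter> V \<in> {U. openin R U \<and> 0 \<in> U}" if "V \<in> {U. openin R U \<and> 0 \<in> U}" for V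
      using U that by auto
    show "\<exists>V\<in>{U. openin R U \<and> 0 \<in> U}. \<forall>x\<in>V. \<forall>y\<in>V. x + y \<in> U"
      using tvs_add_nbhd[OF R(2) U] by blast
    show "\<exists>V\<in>{U. openin R U \<and> 0 \<in> U}. \<forall>t x. norm t \<le> 1 \<longrightarrow> x \<in> V \<longrightarrow> t *s x \<in> U"
      using tvs_balanced_nbhd[OF R(2) U] by blast
    obtain O' where O': "openin E O'" "U = O' \<inter> M" using weaker[OF U(1)] by (auto simp: openin_subtopology)
    then obtain r where "r > 0" "\<forall>y\<in>X. N (y - 0) < r \<longrightarrow> y \<in> O'"
      using U(2) unfolding openin_iff by blast
    then show "\<exists>r>0. \<forall>x\<in>M. N x < r \<longrightarrow> x \<in> U" using O' MX by auto
  next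
    fix x assume x: "\<And>U. U \<in> {U. openin R U \<and> 0 \<in> U} \<Longrightarrow> x \<in> U"
    show "x = 0"
    proof (rule ccontr)
      assume "x \<noteq> 0"
      moreover have "x \<in> M" using x[of M] M0 R(1) openin_topspace[of R] by simp
      ultimately obtain U V where "openin R U" "openin R V" "x \<in> U" "0 \<in> V" "disjnt U V"
        using R(1,3) M0 unfolding Hausdorff_space_def by metis
      with x[of V] show False by (auto simp: disjnt_iff)
    qed
  next
    show "\<exists>r>0. \<forall>U\<in>{U. openin R U \<and> 0 \<in> U}. \<exists>x\<in>U. r \<le> N x"
    proof (rule ccontr)
      assume "\<not> ?thesis"
      then have small: "\<exists>U. openin R U \<and> 0 \<in> U \<and> (\<forall>x\<in>U. N x < r)" if "0 < r" for r
        using that by (auto simp: not_le)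
      have "openin R U" if U: "openin (subtopology E M) U" for U
      proof (subst openin_subopen, intro ballI)
        fix x assume xU: "x \<in> U"
        obtain O' where O': "openin E O'" "U = O' \<inter> M" using U by (auto simp: openin_subtopology)
        then obtain r where r: "r > 0" "\<forall>y\<in>X. N (y - x) < r \<longrightarrow> y \<in> O'"
          using xU unfolding openin_iff by blast
        obtain V where V: "openin R V" "0 \<in> V" "\<forall>v\<in>V. N v < r" using small r by blast
        have xM: "x \<in> M" using xU O' by blast
        have VM: "V \<subseteq> M" using openin_subset[OF V(1)] R(1) by simp
        have "v + x \<in> U" if v: "v \<in> V" for v
        proof -
          have "v + x \<in> M" using v VM xM subspace_add[OF M_sub] by blast
          moreover have "N (v + x - x) < r" using V(3) v by simp
          ultimately show ?thesis using r(2) O'(2) MX by blast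
        qed
        then have "(\<lambda>v. v + x) ` V \<subseteq> U" by blast
        moreover have "openin R ((\<lambda>v. v + x) ` V)"
          using tvs_openin_translation[OF R(2) V(1)] xM R(1) by simp
        moreover have "x \<in> (\<lambda>v. v + x) ` V" using V(2) by force
        ultimately show "\<exists>T. openin R T \<and> x \<in> T \<and> T \<subseteq> U" by blast
      qed
      then have "R = subtopology E M" using weaker by (auto simp: topology_eq)
      with ne show False by blast
    qed
  qed
  then show ?thesis by blast
qed

text \<open>The \<open>u\<close>-parts are too small to spoil the coefficient bound of the
  \<open>e i\<close>, so it carries over to the perturbed vectors \<open>y i\<close>. Approximants
  of a point \<open>z\<close> of the closed span then have uniformly Cauchy coefficients, their
  \<open>u\<close>-parts converge to the sum \<open>k\<close> of a series, and their
  \<open>e\<close>-parts must converge to \<open>z - k\<close>.\<close>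

lemma spaceable_of_c0_lineable:
  assumes W: "subspace W" "W \<subseteq> X" and M: "closedin E M" "M \<subseteq> W"
    and \<delta>: "0 < \<delta>" and e: "range e \<subseteq> M" and M_sub: "subspace M"
    and coeff: "\<And>(n::nat) a. N (\<Sum>i<n. a i *s e i) \<le> \<delta> \<Longrightarrow> \<forall>i<n. norm (a i) \<le> 1"
    and total: "\<forall>a (m :: nat \<Rightarrow> nat) w. (\<forall>j. \<forall>i\<ge>m j. a j i = 0) \<longrightarrow> w \<in> M \<longrightarrow>
      (\<lambda>j. N ((\<Sum>i<m j. a j i *s e i) - w)) \<longlonglongrightarrow> 0 \<longrightarrow>
      (\<forall>i. (\<lambda>j. a j i) \<longlonglongrightarrow> 0) \<longrightarrow> w = 0"
    and x: "range x \<subseteq> X" and indep: "S_independent smul E c0 x"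
    and line: "S_lineable smul E x c0 (X - W)"
  shows "spaceable smul E (X - W)"
proof -
  have xX: "x n \<in> X" and eM: "e n \<in> M" and eX: "e n \<in> X" for n using x e W M by blast+
  \<comment> \<open>With this size, \<open>u\<close>-parts with coefficients in the unit disc stay
    within \<open>\<delta> / 32\<close>.\<close>
  have "\<exists>t. t \<noteq> 0 \<and> norm t \<le> 1 \<and> N (t *s x n) \<le> \<delta> / 64 / 2 ^ n" for n
    using ex_small_scale[OF xX, of "\<delta> / 64 / 2 ^ n" n] \<delta> by (metis divide_pos_pos zero_less_numeral zero_less_power)
  then obtain \<tau> where \<tau>: "\<And>n. \<tau> n \<noteq> 0" "\<And>n. norm (\<tau> n) \<le> 1" "\<And>n. N (\<tau> n *s x n) \<le> \<delta> / 64 / 2 ^ n"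
    by metis
  define u where "u n = \<tau> n *s x n" for n
  define y where "y n = e n + u n" for n
  define S where "S a n = (\<Sum>i<n. a i *s e i)" for a and n :: nat
  define K where "K a n = (\<Sum>i<n. a i *s u i)" for a and n :: nat
  define Y where "Y a n = (\<Sum>i<n. a i *s y i)" for a and n :: nat
  have uX: "u n \<in> X" and yX: "y n \<in> X" for n unfolding y_def u_def by (intro X_add X_scale xX eX)+
  have SX: "S a n \<in> X" and KX: "K a n \<in> X" and YX: "Y a n \<in> X" for a n
    unfolding S_def K_def Y_def by (intro X_sum X_scale eX uX yX)+
  have SM: "S a n \<in> M" for a n unfolding S_def by (intro subspace_sum subspace_scale M_sub eM)
  have Y_eq: "Y a n = S a n + K a n" for a n
    by (simp add: Y_def S_def K_def y_def scale_right_distrib sum.distrib)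
  have S_scale: "S (\<lambda>i. t * a i) n = t *s S a n" and Y_scale: "Y (\<lambda>i. t * a i) n = t *s Y a n" for t a n
    by (simp_all add: S_def Y_def scale_sum_right)
  have Y_diff: "Y (\<lambda>i. a i - b i) n = Y a n - Y b n" and K_diff: "K (\<lambda>i. a i - b i) n = K a n - K b n" for a b n
    by (simp_all add: Y_def K_def scale_left_diff_distrib sum_subtractf)
  have Y_add: "Y (\<lambda>i. a i + b i) n = Y a n + Y b n" for a b n
    by (simp add: Y_def scale_left_distrib sum.distrib)
  have Y_ext: "Y a n = Y a m" and K_ext: "K a n = K a m" if "\<And>i. m \<le> i \<Longrightarrow> a i = 0" "m \<le> n" for a m n
    unfolding Y_def K_def using that by (intro sum.mono_neutral_right; auto)+
  have N_u: "N (b *s u i) \<le> \<delta> / 64 * (1 / 2) ^ i" if "norm b \<le> 1" for b i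
    using order_trans[OF balanced[OF uX that] \<tau>(3)[of i, folded u_def]] by (simp add: power_one_over)
  have geo: "summable (\<lambda>i. \<delta> / 64 * (1 / 2) ^ i)" by (intro summable_mult summable_geometric) simp
  have K_small: "N (K a n) \<le> \<delta> / 32" if "\<forall>i<n. norm (a i) \<le> 1" for a n
  proof -
    have "N (K a n) \<le> (\<Sum>i<n. N (a i *s u i))" unfolding K_def by (intro triangle_sum X_scale uX)
    also have "\<dots> \<le> (\<Sum>i<n. \<delta> / 64 * (1 / 2) ^ i)" using that by (intro sum_mono N_u) simp
    also have "\<dots> = \<delta> / 64 * (\<Sum>i<n. (1 / 2) ^ i)" by (simp add: sum_distrib_left)
    also have "\<dots> \<le> \<delta> / 64 * 2" using \<delta> by (intro mult_left_mono) (simp_all add: sum_gp_strict)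
    finally show ?thesis by simp
  qed
  have coeff_Y: "norm (a i) \<le> 1" if a: "N (Y a n) \<le> \<delta> / 32" and i: "i < n" for a n i
  proof (rule ccontr)
    assume big: "\<not> norm (a i) \<le> 1"
    \<comment> \<open>Normalise by the largest modulus \<open>r\<close>. The \<open>e\<close>-part
      is then at most \<open>\<delta> / 16\<close>, so its double is still within
      \<open>\<delta>\<close>, although one coefficient of the double has modulus 2.\<close>
    define r where "r = Max ((\<lambda>i. norm (a i)) ` {..<n})"
    have "r \<in> (\<lambda>i. norm (a i)) ` {..<n}" unfolding r_def using i by (intro Max_in) auto
    then obtain j where j: "j < n" "norm (a j) = r" by auto
    have r_ge: "norm (a i) \<le> r" if "i < n" for i unfolding r_def using that by (intro Max_ge) auto
    have r: "1 < r" using r_ge[OF i] big by simp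
    define t :: 'k where "t = of_real (1 / r)"
    have norm_t: "norm t = 1 / r" unfolding t_def norm_of_real using r by simp
    have t1: "norm t \<le> 1" using r by (simp add: norm_t)
    have "N (K (\<lambda>i. t * a i) n) \<le> \<delta> / 32"
      using r_ge r by (intro K_small) (simp add: norm_mult norm_t)
    moreover have "N (Y (\<lambda>i. t * a i) n) \<le> \<delta> / 32"
      unfolding Y_scale using balanced[OF YX t1] a by (rule order_trans)
    moreover have "S (\<lambda>i. t * a i) n = Y (\<lambda>i. t * a i) n - K (\<lambda>i. t * a i) n" by (simp add: Y_eq)
    ultimately have "N (S (\<lambda>i. t * a i) n) \<le> \<delta> / 16"
      using triangle_diff[OF YX KX, of "\<lambda>i. t * a i" n "\<lambda>i. t * a i" n] by simp
    then have "N (S (\<lambda>i. of_nat 2 * (t * a i)) n) \<le> \<delta>"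
      using scale_numeral_le[OF SX, of 2 "\<lambda>i. t * a i" n] \<delta> unfolding S_scale by simp
    then have "norm (of_nat 2 * (t * a j)) \<le> 1"
      using coeff[of "\<lambda>i. of_nat 2 * (t * a i)" n] j unfolding S_def by blast
    then show False using j r by (simp add: norm_mult norm_t)
  qed
  have Y_0: "a i = 0" if Y: "Y a n = 0" and i: "i < n" for a n i
  proof (rule ccontr)
    assume nz: "a i \<noteq> 0"
    \<comment> \<open>A vanishing combination vanishes after every rescaling, so a nonzero
      coefficient could be raised to 2, against \<open>coeff_Y\<close>.\<close>
    have "N (Y (\<lambda>j. (2 / a i) * a j) n) \<le> \<delta> / 32" unfolding Y_scale Y using \<delta> by (simp add: N_0)
    from coeff_Y[OF this i] nz show False by simp
  qed
  \<comment> \<open>The span of the \<open>y i\<close>, with coefficients defined at all indices so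
    that combinations of different lengths can be compared by padding.\<close>
  define D where "D = {Y a m |a m. \<forall>i\<ge>m. a i = 0}"
  define Z where "Z = {z \<in> X. \<forall>\<epsilon>>0. \<exists>d\<in>D. N (z - d) < \<epsilon>}"
  have DX: "D \<subseteq> X" using YX by (auto simp: D_def)
  have D_sub: "subspace D"
  proof (rule subspaceI)
    show "0 \<in> D" unfolding D_def Y_def by (intro CollectI exI[of _ "\<lambda>_. 0"] exI[of _ 0]) simp
    fix d assume "d \<in> D"
    then obtain a m where a: "d = Y a m" "\<And>i. m \<le> i \<Longrightarrow> a i = 0" by (auto simp: D_def)
    show "t *s d \<in> D" for t
      unfolding D_def using a Y_scale by (intro CollectI exI[of _ "\<lambda>i. t * a i"] exI[of _ m]) simp
    fix d' assume "d' \<in> D"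
    then obtain b n where b: "d' = Y b n" "\<And>i. n \<le> i \<Longrightarrow> b i = 0" by (auto simp: D_def)
    have "d + d' = Y (\<lambda>i. a i + b i) (max m n)"
      unfolding Y_add using a b Y_ext[of m a "max m n"] Y_ext[of n b "max m n"] by simp
    with a b show "d + d' \<in> D"
      unfolding D_def by (intro CollectI exI[of _ "\<lambda>i. a i + b i"] exI[of _ "max m n"]) simp
  qed
  have Z_closed: "closed_subspace smul E Z"
    unfolding Z_def by (rule closed_subspace_closure[OF D_sub DX])
  have y_Z: "y n \<in> Z" for n
  proof -
    have "y n = Y (\<lambda>i. if i = n then 1 else 0) (Suc n)" by (simp add: Y_def)
    then have "y n \<in> D" unfolding D_def by (intro CollectI exI[of _ "\<lambda>i. if i = n then 1 else 0"] exI[of _ "Suc n"]) simp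
    then show ?thesis unfolding Z_def using yX by (auto intro!: bexI[of _ "y n"] simp: N_0)
  qed
  have "infinite_dimensional smul Z"
    unfolding infinite_dimensional_def
  proof (intro notI, elim exE conjE)
    fix B assume B: "finite B" "Z \<subseteq> span B"
    have "y n \<notin> span (y ` {..<n})" for n
    proof
      assume "y n \<in> span (y ` {..<n})"
      then obtain a where a: "y n = (\<Sum>i<n. a i *s y i)" using span_image_lessThan by blast
      have "Y (a(n := - 1)) (Suc n) = 0" by (simp add: Y_def flip: a)
      from Y_0[OF this, of n] show False by simp
    qed
    from not_finitely_spanned[OF this B(1)] y_Z B(2) show False by blast
  qed
  moreover have "z = 0" if z: "z \<in> Z" "z \<in> W" for z
  proof -
    have zX: "z \<in> X" using z by (simp add: Z_def)
    have "\<exists>d. d \<in> D \<and> N (z - d) < 1 / real (Suc j)" for j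
    proof -
      have "1 / real (Suc j) > 0" by simp
      then show ?thesis using z(1) unfolding Z_def by blast
    qed
    then obtain d where d: "\<And>j. d j \<in> D" "\<And>j. N (z - d j) < 1 / real (Suc j)" by metis
    have dX: "d j \<in> X" for j using d DX by blast
    have d_lim: "(\<lambda>j. N (d j - z)) \<longlonglongrightarrow> 0"
    proof (rule tendsto_sandwich[OF _ _ tendsto_const LIMSEQ_inverse_real_of_nat])
      show "\<forall>\<^sub>F j in sequentially. 0 \<le> N (d j - z)" using nonneg X_diff dX zX by simp
      show "\<forall>\<^sub>F j in sequentially. N (d j - z) \<le> inverse (real (Suc j))"
        using d(2) minus_commute[OF zX dX] by (simp add: inverse_eq_divide less_imp_le)
    qed
    have "\<exists>a m. d j = Y a m \<and> (\<forall>i\<ge>m. a i = 0)" for j using d(1)[of j] by (auto simp: D_def)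
    then obtain a m where am: "\<And>j. d j = Y (a j) (m j)" "\<And>j i. m j \<le> i \<Longrightarrow> a j i = 0" by metis
    \<comment> \<open>An integer multiple \<open>n\<close> of \<open>d j - d k\<close> still lies
      below the threshold of \<open>coeff_Y\<close>; this gives the bound \<open>1 / n\<close> for
      all coefficient differences simultaneously.\<close>
    have cauchy: "\<exists>J. \<forall>j\<ge>J. \<forall>k\<ge>J. \<forall>i. norm (a j i - a k i) \<le> r" if r: "r > 0" for r
    proof -
      obtain n where n: "1 / r \<le> real n" using real_arch_simple by blast
      then have n0: "n > 0" using r by (cases n) (auto simp: field_simps)
      have "\<delta> / 64 / real n > 0" using \<delta> n0 by simp
      then obtain J where J: "\<And>j. j \<ge> J \<Longrightarrow> N (d j - z) < \<delta> / 64 / real n"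
        using order_tendstoD(2)[OF d_lim] unfolding eventually_sequentially by blast
      have "norm (a j i - a k i) \<le> r" if jk: "j \<ge> J" "k \<ge> J" for j k i
      proof (cases "i < max (m j) (m k)")
        case True
        let ?b = "\<lambda>i. a j i - a k i"
        have eq: "Y ?b (max (m j) (m k)) = d j - d k"
          unfolding Y_diff am(1) using Y_ext[of "m j" "a j" "max (m j) (m k)"] Y_ext[of "m k" "a k" "max (m j) (m k)"] am(2)
          by simp
        have "N (Y (\<lambda>i. of_nat n * ?b i) (max (m j) (m k))) \<le> real n * N (d j - d k)"
          unfolding Y_scale eq by (intro scale_numeral_le X_diff dX)
        also have "\<dots> \<le> real n * (\<delta> / 32 / real n)"
        proof (intro mult_left_mono)
          have "N ((d j - z) - (d k - z)) \<le> N (d j - z) + N (d k - z)"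
            by (intro triangle_diff X_diff dX zX)
          with J[OF jk(1)] J[OF jk(2)] show "N (d j - d k) \<le> \<delta> / 32 / real n" by simp
        qed simp
        also have "\<dots> = \<delta> / 32" using n0 by simp
        finally have "norm (of_nat n * ?b i) \<le> 1" using coeff_Y True by blast
        then have "real n * norm (?b i) \<le> 1" by (simp only: norm_mult norm_of_nat)
        then have "norm (?b i) \<le> 1 / real n" using n0 by (simp add: field_simps)
        also have "\<dots> \<le> r" using n n0 r by (simp add: field_simps)
        finally show ?thesis .
      qed (use am(2) r in simp)
      then show ?thesis by blast
    qed
    have "Cauchy (\<lambda>j. a j i)" for i
    proof (rule metric_CauchyI)
      fix r :: real assume "0 < r"
      then obtain J where "\<forall>j\<ge>J. \<forall>k\<ge>J. \<forall>i. norm (a j i - a k i) \<le> r / 2" using cauchy half_gt_zero by blast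
      then have "\<forall>j\<ge>J. \<forall>k\<ge>J. dist (a j i) (a k i) \<le> r / 2" by (simp add: dist_norm)
      then show "\<exists>J. \<forall>j\<ge>J. \<forall>k\<ge>J. dist (a j i) (a k i) < r" using \<open>0 < r\<close>
        by (intro exI[of _ J]) fastforce
    qed
    then have "\<exists>l. (\<lambda>j. a j i) \<longlonglongrightarrow> l" for i using convergent_real_or_complex by metis
    then obtain \<alpha> where \<alpha>: "\<And>i. (\<lambda>j. a j i) \<longlonglongrightarrow> \<alpha> i" by metis
    have unif: "\<exists>J. \<forall>j\<ge>J. \<forall>i. norm (a j i - \<alpha> i) \<le> r" if r: "r > 0" for r
    proof -
      obtain J where J: "\<forall>j\<ge>J. \<forall>k\<ge>J. \<forall>i. norm (a j i - a k i) \<le> r" using cauchy[OF r] by blast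
      have "norm (a j i - \<alpha> i) \<le> r" if "j \<ge> J" for j i
      proof (rule LIMSEQ_le_const2)
        show "(\<lambda>k. norm (a j i - a k i)) \<longlonglongrightarrow> norm (a j i - \<alpha> i)" by (intro tendsto_intros \<alpha>)
        show "\<exists>J. \<forall>k\<ge>J. norm (a j i - a k i) \<le> r" using J that by blast
      qed
      then show ?thesis by blast
    qed
    \<comment> \<open>\<open>\<alpha>\<close> is a uniform limit of finitely supported sequences,
      and the \<open>\<tau> i\<close> have modulus at most 1.\<close>
    have "(\<lambda>i. \<alpha> i * \<tau> i) \<longlonglongrightarrow> 0"
    proof (rule LIMSEQ_I)
      fix r :: real assume "0 < r"
      then obtain J where "\<forall>j\<ge>J. \<forall>i. norm (a j i - \<alpha> i) \<le> r / 2" using unif half_gt_zero by blast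
      then have \<alpha>_le: "norm (\<alpha> i) \<le> r / 2" if "i \<ge> m J" for i using am(2)[OF that] by (metis diff_0 norm_minus_cancel order_refl)
      have \<tau>_le: "norm (\<alpha> i * \<tau> i) \<le> norm (\<alpha> i)" for i
        using mult_left_le[OF \<tau>(2) norm_ge_zero] by (simp add: norm_mult)
      have "norm (\<alpha> i * \<tau> i - 0) < r" if "i \<ge> m J" for i
        using \<alpha>_le[OF that] \<tau>_le[of i] \<open>0 < r\<close> by simp
      then show "\<exists>n. \<forall>i\<ge>n. norm (\<alpha> i * \<tau> i - 0) < r" by blast
    qed
    then have c0: "(\<lambda>i. \<alpha> i * \<tau> i) \<in> c0" by (simp add: c0_def)
    then obtain k where k: "k \<in> (X - W) \<union> {0}" and conv: "series_converges_to smul E x (\<lambda>i. \<alpha> i * \<tau> i) k"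
      using line unfolding S_lineable_def by blast
    have kX: "k \<in> X" using k X_0 by blast
    have K_\<alpha>: "K \<alpha> n = (\<Sum>i<n. (\<alpha> i * \<tau> i) *s x i)" for n by (simp add: K_def u_def)
    have K_lim: "(\<lambda>n. N (K \<alpha> n - k)) \<longlonglongrightarrow> 0"
      using conv unfolding series_converges_to_def K_\<alpha>[symmetric] limitin_iff[OF KX kX] .
    \<comment> \<open>Interchange of limits by Tannery's theorem: each term tends to 0 and the
      geometric bound of \<open>N_u\<close> dominates.\<close>
    have K_a: "(\<lambda>j. N (K (a j) (m j) - k)) \<longlonglongrightarrow> 0"
    proof -
      define g where "g i j = N ((a j i - \<alpha> i) *s u i)" for i j
      obtain J where J: "\<And>j i. j \<ge> J \<Longrightarrow> norm (a j i - \<alpha> i) \<le> 1" using unif[of 1] by auto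
      have g_nonneg: "0 \<le> g i j" for i j unfolding g_def by (intro nonneg X_scale uX)
      have g_le: "g i j \<le> \<delta> / 64 * (1 / 2) ^ i" if "j \<ge> J" for i j
        unfolding g_def by (intro N_u J that)
      have "(\<lambda>j. g i j) \<longlonglongrightarrow> 0" for i
      proof -
        have "(\<lambda>j. a j i - \<alpha> i) \<longlonglongrightarrow> 0" using \<alpha>[of i] by (rule LIM_zero)
        \<comment> \<open>A sum with one term: the shift by \<open>i'\<close> moves index 0 to index
          \<open>i\<close>, since \<open>sum_scale_tendsto_0\<close> is about initial
          segments.\<close>
        then have "(\<lambda>j. N (\<Sum>i<1::nat. (a j (i + i') - \<alpha> (i + i')) *s u (i + i'))) \<longlonglongrightarrow> 0" if "i' = i" for i'
          using that by (intro sum_scale_tendsto_0 uX) simp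
        then show ?thesis by (simp add: g_def)
      qed
      moreover have "\<forall>\<^sub>F (i, j) in at_top \<times>\<^sub>F sequentially. norm (g i j) \<le> \<delta> / 64 * (1 / 2) ^ i"
      proof -
        have "\<forall>\<^sub>F (i :: nat, j) in at_top \<times>\<^sub>F sequentially. J \<le> j"
          by (subst eventually_prod2) (simp_all add: eventually_ge_at_top)
        then show ?thesis by (rule eventually_mono) (use g_le g_nonneg in auto)
      qed
      moreover have "sequentially \<noteq> bot" by simp
      ultimately have sum_lim: "(\<lambda>j. \<Sum>i. g i j) \<longlonglongrightarrow> (\<Sum>i. 0 :: real)"
        using tannerys_theorem[of g "\<lambda>_. 0" sequentially, OF _ _ geo] by blast
      \<comment> \<open>\<open>k\<close> is accessible only as a limit, so the estimate is made for
        \<open>K \<alpha> n\<close> and \<open>n\<close> tends to infinity.\<close>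
      have "N (K (a j) (m j) - k) \<le> (\<Sum>i. g i j)" if j: "j \<ge> J" for j
      proof (rule LIMSEQ_le_const)
        show "(\<lambda>n. (\<Sum>i. g i j) + N (K \<alpha> n - k)) \<longlonglongrightarrow> (\<Sum>i. g i j)"
          using tendsto_add[OF tendsto_const K_lim, of "\<Sum>i. g i j"] by simp
        have smg: "summable (\<lambda>i. g i j)"
          using g_le[OF j] g_nonneg by (intro summable_comparison_test'[OF geo]) auto
        have "N (K (a j) (m j) - k) \<le> (\<Sum>i. g i j) + N (K \<alpha> n - k)" if n: "n \<ge> m j" for n
        proof -
          have "K (a j) (m j) - K \<alpha> n = K (\<lambda>i. a j i - \<alpha> i) n"
            using K_ext[of "m j" "a j" n] am(2) n by (simp add: K_diff)
          then have "N (K (a j) (m j) - K \<alpha> n) \<le> (\<Sum>i<n. g i j)"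
            by (simp only: K_def g_def) (intro triangle_sum X_scale uX)
          also have "\<dots> \<le> (\<Sum>i. g i j)" using smg g_nonneg by (intro sum_le_suminf) auto
          finally show ?thesis
            using triangle[OF X_diff[OF KX KX] X_diff[OF KX kX], of "a j" "m j" \<alpha> n \<alpha> n] by simp
        qed
        then show "\<exists>n0. \<forall>n\<ge>n0. N (K (a j) (m j) - k) \<le> (\<Sum>i. g i j) + N (K \<alpha> n - k)" by blast
      qed
      then have le: "\<forall>\<^sub>F j in sequentially. N (K (a j) (m j) - k) \<le> (\<Sum>i. g i j)"
        unfolding eventually_sequentially by blast
      have ge: "\<forall>\<^sub>F j in sequentially. 0 \<le> N (K (a j) (m j) - k)"
        using nonneg X_diff KX kX by simp
      show ?thesis
        using tendsto_sandwich[OF ge le tendsto_const] sum_lim by simp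
    qed
    have S_a: "(\<lambda>j. N (S (a j) (m j) - (z - k))) \<longlonglongrightarrow> 0"
    proof (rule tendsto_sandwich[OF _ _ tendsto_const])
      show "(\<lambda>j. N (d j - z) + N (K (a j) (m j) - k)) \<longlonglongrightarrow> 0"
        using tendsto_add[OF d_lim K_a] by simp
      have "N (S (a j) (m j) - (z - k)) \<le> N (d j - z) + N (K (a j) (m j) - k)" for j
      proof -
        have "S (a j) (m j) - (z - k) = (d j - z) - (K (a j) (m j) - k)" by (simp add: am(1) Y_eq)
        then show ?thesis
          using triangle_diff[OF X_diff[OF dX zX] X_diff[OF KX kX], of j "a j" "m j"] by (simp only:)
      qed
      then show "\<forall>\<^sub>F j in sequentially. N (S (a j) (m j) - (z - k)) \<le> N (d j - z) + N (K (a j) (m j) - k)"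
        by simp
      show "\<forall>\<^sub>F j in sequentially. 0 \<le> N (S (a j) (m j) - (z - k))"
        using nonneg X_diff SX zX kX by simp
    qed
    have w: "z - k \<in> M" using closedin_limit[OF M(1) SM X_diff[OF zX kX] S_a] .
    \<comment> \<open>Both \<open>z\<close> and \<open>z - k\<close> lie in \<open>W\<close>, hence
      so does \<open>k\<close>; lineability leaves only \<open>k = 0\<close>.\<close>
    then have "z - (z - k) \<in> W" using M(2) z W(1) subspace_diff by blast
    then have k0: "k = 0" using k by simp
    then have "\<alpha> i * \<tau> i = 0" for i
      using indep c0 conv unfolding S_independent_def by blast
    then have "\<alpha> i = 0" for i using \<tau>(1) by simp
    then have "(\<lambda>j. a j i) \<longlonglongrightarrow> 0" for i using \<alpha> by metis
    \<comment> \<open>All coefficients of the approximants tend to 0, so the uniqueness clause for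
      the \<open>e i\<close> applies to the limit of the \<open>e\<close>-parts.\<close>
    then have "z - k = 0"
      using total am(2) w S_a[unfolded S_def] by blast
    with k0 show "z = 0" by simp
  qed
  then have "Z \<subseteq> (X - W) \<union> {0}" using Z_def by blast
  ultimately show ?thesis unfolding spaceable_def using Z_closed by blast
qed

end

theorem theorem3p1:
  fixes smul :: "'k::real_or_complex \<Rightarrow> 'a::ab_group_add \<Rightarrow> 'a"
    and E :: "'a topology" and W :: "'a set"
  assumes "F_space smul E"
    and "module.subspace smul W" and "W \<subseteq> topspace E"
    and "\<exists>M. closed_subspace smul E M \<and> M \<subseteq> W \<and> nonminimal_tvs smul (subtopology E M)"
  shows "spaceable smul E (topspace E - W) \<longleftrightarrow>
    (\<exists>\<S> x. closed_subspace seq_scale linf_topology \<S> \<and> c0 \<subseteq> \<S> \<and>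
           range x \<subseteq> topspace E \<and> S_independent smul E \<S> x \<and>
           S_lineable smul E x \<S> (topspace E - W))"
    (is "?lhs \<longleftrightarrow> ?rhs")
proof -
  obtain N where "F_space_norm smul E N"
    using F_space_imp_F_space_norm[OF assms(1)] by blast
  then interpret F_space_norm smul E N .
  show ?thesis
  proof
    assume ?lhs
    then obtain S where S: "closed_subspace smul E S" "infinite_dimensional smul S"
      and SW: "S \<subseteq> (topspace E - W) \<union> {0}" unfolding spaceable_def by blast
    obtain x where x: "range x \<subseteq> S" "S_independent smul E linf x"
      and conv: "\<And>c. c \<in> linf \<Longrightarrow> \<exists>l\<in>S. series_converges_to smul E x c l"
      by (rule ex_linf_independent_sequence[OF S]) (rule that)
    have "S \<subseteq> topspace E" using SW X_0 by blast
    then have "range x \<subseteq> topspace E" using x by blast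
    moreover have "S_lineable smul E x linf (topspace E - W)"
      unfolding S_lineable_def using conv SW by blast
    ultimately show ?rhs using closed_subspace_linf c0_subset_linf x(2) by blast
  next
    assume ?rhs
    then obtain \<S> x where c0: "c0 \<subseteq> \<S>" and x: "range x \<subseteq> topspace E"
      and indep: "S_independent smul E \<S> x" and line: "S_lineable smul E x \<S> (topspace E - W)"
      by blast
    obtain M where M: "closed_subspace smul E M" "M \<subseteq> W" "nonminimal_tvs smul (subtopology E M)"
      using assms(4) by blast
    obtain \<U> where "weaker_vector_topology smul M N \<U>"
      using nonminimal_imp_weaker_vector_topology[OF M(1,3)] by blast
    then interpret M: weaker_vector_topology smul M N \<U> .
    obtain e \<delta> where basic: "0 < \<delta>" "range e \<subseteq> M"
      "\<And>(n::nat) a. N (\<Sum>i<n. smul (a i) (e i)) \<le> \<delta> \<Longrightarrow> \<forall>i<n. norm (a i) \<le> 1"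
      "\<forall>a (m :: nat \<Rightarrow> nat) w. (\<forall>j. \<forall>i\<ge>m j. a j i = 0) \<longrightarrow> w \<in> M \<longrightarrow>
        (\<lambda>j. N ((\<Sum>i<m j. smul (a j i) (e i)) - w)) \<longlonglongrightarrow> 0 \<longrightarrow>
        (\<forall>i. (\<lambda>j. a j i) \<longlonglongrightarrow> 0) \<longrightarrow> w = 0"
      by (rule M.basic_sequence[OF compact_cball_real_or_complex]) (rule that)
    show ?lhs
    proof (rule spaceable_of_c0_lineable[OF assms(2,3) _ M(2) basic(1,2)])
      show "closedin E M" "subspace M" using M(1) by (simp_all add: closed_subspace_def)
      show "range x \<subseteq> topspace E" by fact
      \<comment> \<open>Independence and lineability both pass to smaller coefficient
        spaces.\<close>
      show "S_independent smul E c0 x" using indep c0 unfolding S_independent_def by blast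
      show "S_lineable smul E x c0 (topspace E - W)" using line c0 unfolding S_lineable_def by blast
    qed (fact basic(3), fact basic(4))
  qed
qed

end
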